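(* Let $k\ge2$ and $T\ge 0$ be integers. For $\sigma_\varnothing^T,u^T\in\{-1,+1\}^{T+1}$ define $$\Psi^0_{\mathrm{odd},T}(\sigma_\varnothing^T\|u^T)=\mathbb P(\sigma_\varnothing^T\|u^T),\qquad \Psi^0_{\mathrm{even},T}(\sigma_\varnothing^T\|u^T)=\mathbb P(\sigma_\varnothing^T\|u^T)\,\mathbb I(\sigma_\varnothing(T)=-1),$$ and, recursively for $d\ge0$, $$\Psi^{d+1}_{\mathrm{odd},T}(\sigma_\varnothing^T\|u^T)=\mathbb P_0(\sigma_\varnothing(0))\sum_{r=\lceil\frac{k+1}{2}\rceil-1}^{k-1}\binom{k-1}{r}\sum_{\sigma_1^T,\dots,\sigma_{k-1}^T}\ \prod_{t=0}^{T-1}\mathsf K_{u(t)}\big(\sigma_\varnothing(t+1)|\sigma_{\partial\varnothing}(t)\big)\prod_{i=1}^{r}\Psi^d_{\mathrm{even},T}(\sigma_i^T\|\sigma_\varnothing^T)\prod_{i=r+1}^{k-1}\big\{\mathbb P(\sigma_i^T\|\sigma_\varnothing^T)-\Psi^d_{\mathrm{even},T}(\sigma_i^T\|\sigma_\varnothing^T)\big\},$$ $$\Psi^{d+1}_{\mathrm{even},T}(\sigma_\varnothing^T\|u^T)=\mathbb I(\sigma_\varnothing(T)=-1)\,\mathbb P_0(\sigma_\varnothing(0))\sum_{r=\lceil\frac{k+1}{2}\rceil-1}^{k-1}\binom{k-1}{r}\sum_{\sigma_1^T,\dots,\sigma_{k-1}^T}\ \prod_{t=0}^{T-1}\mathsf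 K_{u(t)}\big(\sigma_\varnothing(t+1)|\sigma_{\partial\varnothing}(t)\big)\prod_{i=1}^{r}\Psi^d_{\mathrm{odd},T}(\sigma_i^T\|\sigma_\varnothing^T)\prod_{i=r+1}^{k-1}\big\{\mathbb P(\sigma_i^T\|\sigma_\varnothing^T)-\Psi^d_{\mathrm{odd},T}(\sigma_i^T\|\sigma_\varnothing^T)\big\},$$ where the inner sums run over $\sigma_1^T,\dots,\sigma_{k-1}^T\in\{-1,+1\}^{T+1}$. Then the limit $\Psi_{\mathrm{odd},T}(\sigma^T\|u^T)=\lim_{d\to\infty}\Psi^d_{\mathrm{odd},T}(\sigma^T\|u^T)$ exists for all $\sigma^T,u^T\in\{-1,+1\}^{T+1}$. Moreover, defining $$\theta_{\mathrm{lb}}(k,T)=\sup\big\{\theta\in[0,1]:\ \Psi_{\mathrm{odd},T}(\sigma^T\|u^T)>0\ \text{ for all }\sigma^T,u^T\in\{-1,+1\}^{T+1}\big\},$$ one has, for every $k$ and $T$, $\theta_*(k)\ge\theta_{\mathrm{lb}}(k,T)$.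
   Context: Majority process and threshold. Let $\mathcal G=(\mathcal V,\mathcal E)$ be the infinite regular tree of degree $k$, and $\partial i$ the set of neighbors of $i$. Spins $\sigma_i(t)\in\{-1,+1\}$, $t=0,1,\dots$, are updated synchronously: if $\sum_{j\in\partial i}\sigma_j(t)\ne0$ then $\sigma_i(t+1)=\mathrm{sign}(\sum_{j\in\partial i}\sigma_j(t))$; in case of a tie, $\sigma_i(t+1)=\pm\sigma_i(t)$ with probability $1/2$ each, using coins independent across vertices and times and independent of the initial configuration. $\mathbb P_\theta$ is the law when the $\sigma_i(0)$ are i.i.d. with $\mathbb P_\theta\{\sigma_i(0)=+1\}=(1+\theta)/2$. The consensus threshold is $\theta_*(k)=\inf\{\theta:\mathbb P_\theta(\lim_{t\to\infty}\sigma_i(t)=+1\text{ for all }i\in\mathcal V)=1\}$. Dynamics under external field. Let $\mathcal G_\varnothing$ be the infinite tree rooted at a vertex $\varnothing$ in which the root has degree $k-1$ (neighbors $1,\dots,k-1$) and every other vertex has degree $k$. Given a sequence $u=(u(0),u(1),\dots)$, non-root spins are updated by the majority rule above (in $\mathcal G_\varnothing$), while $\sigma_\varnothing(t+1)=\mathrm{sign}\big(\sum_{i=1}^{k-1}\sigma_i(t)+u(t)\big)$, with $\sigma_\varnothing(t+1)$ uniform on $\{\pm1\}$ (independent coin) when the argument is $0$. Initial spins are i.i.d. with common distribution $\mathbb P_0(\pm1)=(1\pm\theta)/2$. Write $a^T=(a(0),\dots,a(T))$ for a sequence $a$. $\mathbb P(\sigma_\varnothing^T\|u^T)$ is the probability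 that the root spin follows the trajectory $\sigma_\varnothing^T$ under this dynamics (not a conditional probability); it depends on $\theta$ and $k$. Kernel. $\mathsf K_{u(t)}(\sigma_\varnothing(t+1)|\sigma_{\partial\varnothing}(t))=\mathbb I\{\sigma_\varnothing(t+1)=\mathrm{sign}(\sum_{i=1}^{k-1}\sigma_i(t)+u(t))\}$ if $\sum_{i=1}^{k-1}\sigma_i(t)+u(t)\ne0$, and $=1/2$ otherwise. $\mathbb I$ denotes the indicator; empty products are $1$. The supremum of the empty subset of $[0,1]$ is taken to be $0$. *)

theory Defs
  imports "HOL-Probability.Probability"
begin

section \<open>The two trees\<close>

text \<open>
  A vertex is the list of child labels read from the vertex up to the base point \<open>[]\<close>, so the
  parent of \<open>x # v\<close> is \<open>v\<close>. In the regular tree the base point \<open>[]\<close> has the \<open>k\<close> children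
  \<open>[1], \<dots>, [k]\<close>, and every other vertex has \<open>k - 1\<close> children besides its parent. In the rooted tree
  every vertex has \<open>k - 1\<close> children, so that only the root \<open>[]\<close> has degree \<open>k - 1\<close>.
\<close>

definition regular_tree :: "nat \<Rightarrow> nat list set" where
  "regular_tree k = {v. set (butlast v) \<subseteq> {1..k - 1} \<and> (v \<noteq> [] \<longrightarrow> last v \<in> {1..k})}"

definition rooted_tree :: "nat \<Rightarrow> nat list set" where
  "rooted_tree k = lists {1..k - 1}"

definition nbrs :: "nat list set \<Rightarrow> nat list \<Rightarrow> nat list set" where
  "nbrs V i = {j \<in> V. (\<exists>x. j = x # i) \<or> (\<exists>x. i = x # j)}"

lemma card_nbrs_regular_tree:
  assumes "k \<ge> 2" "i \<in> regular_tree k"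
  shows "card (nbrs (regular_tree k) i) = k"
proof (cases i)
  case Nil
  then have "nbrs (regular_tree k) i = (\<lambda>x. [x]) ` {1..k}"
    by (auto simp: nbrs_def regular_tree_def)
  then show ?thesis by (simp add: card_image inj_on_def)
next
  case (Cons y v)
  have "nbrs (regular_tree k) i = insert v ((\<lambda>x. x # i) ` {1..k - 1})"
    using assms(2) Cons by (auto simp: nbrs_def regular_tree_def split: if_splits)
  moreover have "v \<notin> (\<lambda>x. x # i) ` {1..k - 1}"
    using Cons by auto
  ultimately show ?thesis
    using assms(1) by (simp add: card_image inj_on_def)
qed

lemma nbrs_rooted_tree_root: "nbrs (rooted_tree k) [] = (\<lambda>x. [x]) ` {1..k - 1}"
  by (auto simp: nbrs_def rooted_tree_def)

lemma card_nbrs_rooted_tree: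
  assumes "k \<ge> 2" "i \<in> rooted_tree k" "i \<noteq> []"
  shows "card (nbrs (rooted_tree k) i) = k"
proof -
  obtain y v where i: "i = y # v" using assms(3) by (cases i) auto
  have "nbrs (rooted_tree k) i = insert v ((\<lambda>x. x # i) ` {1..k - 1})"
    using assms(2) i by (auto simp: nbrs_def rooted_tree_def)
  moreover have "v \<notin> (\<lambda>x. x # i) ` {1..k - 1}"
    using i by auto
  ultimately show ?thesis
    using assms(1) by (simp add: card_image inj_on_def)
qed


section \<open>Randomness\<close>

text \<open>Meaningful for \<open>\<theta> \<in> {-1..1}\<close> only: \<^const>\<open>bernoulli_pmf\<close> clips its parameter to \<open>{0..1}\<close>.\<close>

definition spin_pmf :: "real \<Rightarrow> int pmf" where
  "spin_pmf \<theta> = map_pmf (\<lambda>b. if b then 1 else - 1) (bernoulli_pmf ((1 + \<theta>) / 2))"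

definition coin_pmf :: "int pmf" where
  "coin_pmf = pmf_of_set {- 1, 1}"

text \<open>
  A sample point is a pair of the initial configuration and the coins; the coin used for
  the update of vertex \<open>i\<close> from time \<open>t\<close> to time \<open>t + 1\<close> is the one with index \<open>(i, t)\<close>.
\<close>

type_synonym sample = "(nat list \<Rightarrow> int) \<times> (nat list \<times> nat \<Rightarrow> int)"

definition sample_space :: "real \<Rightarrow> nat list set \<Rightarrow> sample measure" where
  "sample_space \<theta> V =
     PiM V (\<lambda>_. measure_pmf (spin_pmf \<theta>)) \<Otimes>\<^sub>M PiM (V \<times> UNIV) (\<lambda>_. measure_pmf coin_pmf)"


section \<open>Majority process and consensus threshold\<close>

primrec majority :: "nat list set \<Rightarrow> sample \<Rightarrow> nat \<Rightarrow> nat list \<Rightarrow> int" where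
  "majority V \<omega> 0 i = fst \<omega> i"
| "majority V \<omega> (Suc t) i =
     (let s = (\<Sum>j\<in>nbrs V i. majority V \<omega> t j)
      in if s \<noteq> 0 then sgn s else snd \<omega> (i, t) * majority V \<omega> t i)"

definition theta_star :: "nat \<Rightarrow> real" where
  "theta_star k = Inf {\<theta> \<in> {- 1..1}.
     \<P>(\<omega> in sample_space \<theta> (regular_tree k).
        \<forall>i\<in>regular_tree k. (\<lambda>t. majority (regular_tree k) \<omega> t i) \<longlonglongrightarrow> 1) = 1}"


section \<open>Dynamics under an external field\<close>

primrec field_majority :: "nat \<Rightarrow> (nat \<Rightarrow> int) \<Rightarrow> sample \<Rightarrow> nat \<Rightarrow> nat list \<Rightarrow> int" where
  "field_majority k u \<omega> 0 i = fst \<omega> i"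
| "field_majority k u \<omega> (Suc t) i =
     (if i = [] then
        (let s = (\<Sum>j\<in>nbrs (rooted_tree k) []. field_majority k u \<omega> t j) + u t
         in if s \<noteq> 0 then sgn s else snd \<omega> ([], t))
      else
        (let s = (\<Sum>j\<in>nbrs (rooted_tree k) i. field_majority k u \<omega> t j)
         in if s \<noteq> 0 then sgn s else snd \<omega> (i, t) * field_majority k u \<omega> t i))"

definition trajs :: "nat \<Rightarrow> (nat \<Rightarrow> int) set" where
  "trajs T = {0..T} \<rightarrow>\<^sub>E {- 1, 1}"

text \<open>The probability $P(\sigma^T \| u^T)$; only \<open>u 0, \<dots>, u (T - 1)\<close> enter.\<close>

definition root_prob :: "nat \<Rightarrow> real \<Rightarrow> nat \<Rightarrow> (nat \<Rightarrow> int) \<Rightarrow> (nat \<Rightarrow> int) \<Rightarrow> real" where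
  "root_prob k \<theta> T \<sigma> u =
     \<P>(\<omega> in sample_space \<theta> (rooted_tree k). \<forall>t\<le>T. field_majority k u \<omega> t [] = \<sigma> t)"

definition kernel :: "nat \<Rightarrow> int \<Rightarrow> int \<Rightarrow> (nat \<Rightarrow> int) \<Rightarrow> real" where
  "kernel k a b x =
     (let s = (\<Sum>i=1..k - 1. x i) + a in if s \<noteq> 0 then of_bool (b = sgn s) else 1 / 2)"


section \<open>The recursion and the lower bound\<close>

definition psi_step ::
  "nat \<Rightarrow> real \<Rightarrow> nat \<Rightarrow> ((nat \<Rightarrow> int) \<Rightarrow> (nat \<Rightarrow> int) \<Rightarrow> real) \<Rightarrow> (nat \<Rightarrow> int) \<Rightarrow> (nat \<Rightarrow> int) \<Rightarrow> real"
where
  "psi_step k \<theta> T \<Phi> \<sigma> u =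
     pmf (spin_pmf \<theta>) (\<sigma> 0) *
     (\<Sum>r = nat \<lceil>(real k + 1) / 2\<rceil> - 1..k - 1. real ((k - 1) choose r) *
       (\<Sum>s \<in> {1..k - 1} \<rightarrow>\<^sub>E trajs T.
          (\<Prod>t<T. kernel k (u t) (\<sigma> (t + 1)) (\<lambda>i. s i t)) *
          (\<Prod>i=1..r. \<Phi> (s i) \<sigma>) *
          (\<Prod>i=r + 1..k - 1. root_prob k \<theta> T (s i) \<sigma> - \<Phi> (s i) \<sigma>)))"

fun psi_odd :: "nat \<Rightarrow> real \<Rightarrow> nat \<Rightarrow> nat \<Rightarrow> (nat \<Rightarrow> int) \<Rightarrow> (nat \<Rightarrow> int) \<Rightarrow> real"
and psi_even :: "nat \<Rightarrow> real \<Rightarrow> nat \<Rightarrow> nat \<Rightarrow> (nat \<Rightarrow> int) \<Rightarrow> (nat \<Rightarrow> int) \<Rightarrow> real"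
where
  "psi_odd k \<theta> T 0 \<sigma> u = root_prob k \<theta> T \<sigma> u"
| "psi_even k \<theta> T 0 \<sigma> u = root_prob k \<theta> T \<sigma> u * of_bool (\<sigma> T = - 1)"
| "psi_odd k \<theta> T (Suc d) \<sigma> u = psi_step k \<theta> T (psi_even k \<theta> T d) \<sigma> u"
| "psi_even k \<theta> T (Suc d) \<sigma> u = of_bool (\<sigma> T = - 1) * psi_step k \<theta> T (psi_odd k \<theta> T d) \<sigma> u"

definition psi_odd_lim :: "nat \<Rightarrow> real \<Rightarrow> nat \<Rightarrow> (nat \<Rightarrow> int) \<Rightarrow> (nat \<Rightarrow> int) \<Rightarrow> real" where
  "psi_odd_lim k \<theta> T \<sigma> u = lim (\<lambda>d. psi_odd k \<theta> T d \<sigma> u)"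

text \<open>\<^term>\<open>Sup {} :: real\<close> is unspecified, hence the explicit convention for the empty set.\<close>

definition theta_lb :: "nat \<Rightarrow> nat \<Rightarrow> real" where
  "theta_lb k T =
     (let S = {\<theta> \<in> {0..1}. \<forall>\<sigma>\<in>trajs T. \<forall>u\<in>trajs T. psi_odd_lim k \<theta> T \<sigma> u > 0}
      in if S = {} then 0 else Sup S)"

end

theory Submission imports Defs begin

text \<open>
  A tie broken by "keep or flip the own spin with probability 1/2" has the same law as a tie broken
  by a fresh uniform spin. With fresh spins the dynamics is monotone in the initial configuration,
  so almost sure consensus at some \<open>\<theta>\<close> propagates to all larger parameters, and it fails at
  \<open>\<theta> = 0\<close> by symmetry. Moreover, given the trajectory of the root, the branches at the root evolve
  independently, each under the dynamics in the external field given by that trajectory. Hence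
  the recursion computes the probability that the root follows \<open>\<sigma>\<close> and is the top of an alternating
  structure of depth \<open>d\<close>: its even vertices have spin \<open>- 1\<close> at time \<open>T\<close>, and each vertex has
  at least \<open>\<lceil>(k + 1) / 2\<rceil> - 1\<close> children in it. These events decrease in \<open>d\<close>, so the limit exists.
  If all limits are positive, then with probability bounded below uniformly in \<open>d\<close> the root of the
  regular tree has spin \<open>- 1\<close> up to time \<open>T\<close> and each neighbour is the top of a structure of depth \<open>d\<close>.
  The structure forces its odd vertices to be \<open>- 1\<close> at time \<open>T + 1\<close>, its even vertices
  at time \<open>T + 2\<close>, and so on, so the root is \<open>- 1\<close> at the times \<open>T, T + 2, \<dots>, T + d\<close>, and
  consensus fails.
\<close>

section \<open>Product laws and adapted coin flips\<close>

text \<open>Under the keep-or-flip rule a coin \<open>- 1\<close> turns the larger of two own spins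
  into the smaller one, so paths cannot be compared; moreover the root obeys different tie rules in
  the two processes. Fresh coins remove both difficulties and leave the single dynamics
  \<open>dyn\<close>. No conditioning on the root trajectory takes place. The root and its branches
  influence each other, but once the trajectories of the root and of its children are prescribed,
  the event is a conjunction of conditions on disjoint sets of coordinates, and its probability is
  an exact product. The number \<open>n\<close> of children of the root stays free:
  \<open>n = k - 1\<close> yields the recursion, \<open>n = k\<close> the estimate on the regular
  tree. A vertex of the odd class is guaranteed \<open>k div 2\<close> children with spin
  \<open>- 1\<close>, which is no strict majority of \<open>k\<close>; its parent supplies the
  missing vote. The top of a structure therefore needs outside support, and this comes from a root
  with spin \<open>- 1\<close> whose \<open>k\<close> neighbours all carry the structure and vote it
  back to \<open>- 1\<close> every second step.\<close>

lemma distr_PiM_map: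
  assumes M: "\<And>i. i \<in> I \<Longrightarrow> prob_space (M i)"
    and h[measurable]: "\<And>i. i \<in> I \<Longrightarrow> h i \<in> measurable (M i) (N i)"
  shows "distr (PiM I M) (PiM I N) (\<lambda>f. \<lambda>i\<in>I. h i (f i)) = PiM I (\<lambda>i. distr (M i) (N i) (h i))"
    (is "?D = ?R")
proof (rule measure_eqI_PiM_infinite[symmetric, OF refl])
  have P: "prob_space (distr (M i) (N i) (h i))" if "i \<in> I" for i
    using M[OF that] h[OF that] by (rule prob_space.prob_space_distr)
  then interpret R: prob_space ?R by (rule prob_space_PiM)
  show "finite_measure ?R" by unfold_locales
  show "sets ?D = sets ?R" by (simp cong: sets_PiM_cong)
  fix A J assume J: "finite J" "J \<subseteq> I"
    and A: "\<And>i. i \<in> J \<Longrightarrow> A i \<in> sets (distr (M i) (N i) (h i))"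
  let ?E = "prod_emb I (\<lambda>i. distr (M i) (N i) (h i)) J (Pi\<^sub>E J A)"
  let ?B = "\<lambda>i. h i -` A i \<inter> space (M i)"
  have m: "(\<lambda>f. \<lambda>i\<in>I. h i (f i)) \<in> measurable (PiM I M) (PiM I N)"
    by measurable
  have E: "?E \<in> sets (PiM I N)"
    using J A by (subst sets_PiM_cong[OF refl, of I N "\<lambda>i. distr (M i) (N i) (h i)"]) (auto intro!: sets_PiM_I)
  have "emeasure ?D ?E = emeasure (PiM I M) ((\<lambda>f. \<lambda>i\<in>I. h i (f i)) -` ?E \<inter> space (PiM I M))"
    by (rule emeasure_distr[OF m E])
  also have "(\<lambda>f. \<lambda>i\<in>I. h i (f i)) -` ?E \<inter> space (PiM I M) = prod_emb I M J (Pi\<^sub>E J ?B)"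
    using J h[THEN measurable_space] by (auto simp: prod_emb_def space_PiM PiE_iff subset_iff)
  also have "emeasure (PiM I M) \<dots> = (\<Prod>i\<in>J. emeasure (M i) (?B i))"
  proof (rule emeasure_PiM_emb)
    show "?B i \<in> sets (M i)" if "i \<in> J" for i
      using A[OF that] J that by (intro measurable_sets[OF h]) auto
  qed (use J M in auto)
  also have "\<dots> = (\<Prod>i\<in>J. emeasure (distr (M i) (N i) (h i)) (A i))"
    using J A by (intro prod.cong refl emeasure_distr[symmetric]) auto
  also have "\<dots> = emeasure ?R ?E"
    using J A P by (intro emeasure_PiM_emb[symmetric]) auto
  finally show "emeasure ?R ?E = emeasure ?D ?E" ..
qed

text \<open>
  The coordinate \<open>(v, 0)\<close> is the initial spin of \<open>v\<close>; the coordinate \<open>(v, Suc t)\<close> is the spin that \<open>v\<close>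
  adopts at time \<open>Suc t\<close> in case of a tie.
\<close>

definition site :: "real \<Rightarrow> nat list \<times> nat \<Rightarrow> int measure" where
  "site \<theta> p = measure_pmf (if snd p = 0 then spin_pmf \<theta> else coin_pmf)"

definition law :: "real \<Rightarrow> nat list set \<Rightarrow> (nat list \<times> nat \<Rightarrow> int) measure" where
  "law \<theta> V = PiM (V \<times> UNIV) (site \<theta>)"

lemma prob_space_site: "prob_space (site \<theta> p)"
  by (simp add: site_def measure_pmf.prob_space_axioms)

lemma sets_site[measurable_cong]: "sets (site \<theta> p) = sets (count_space UNIV)"
  by (simp add: site_def)

lemma measurable_site: "measurable M (site \<theta> p) = measurable M (count_space UNIV)"
  by (rule measurable_cong_sets) (simp_all add: site_def)

lemma sets_Collect_discrete:
  assumes "f \<in> measurable M (count_space UNIV)"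
  shows "{x \<in> space M. P (f x)} \<in> sets M"
proof -
  have "{x \<in> space M. P (f x)} = f -` Collect P \<inter> space M" by auto
  then show ?thesis using measurable_sets[OF assms, of "Collect P"] by simp
qed

lemma space_site[simp]: "space (site \<theta> p) = UNIV"
  by (simp add: site_def)

lemma prob_space_law: "prob_space (law \<theta> V)"
  unfolding law_def by (intro prob_space_PiM prob_space_site)

lemma prob_space_sample: "prob_space (sample_space \<theta> V)"
  unfolding sample_space_def
  by (intro prob_space_pair prob_space_PiM measure_pmf.prob_space_axioms)

lemma coin_set: "set_pmf coin_pmf = {-1, 1}"
  by (simp add: coin_pmf_def)

lemma spin_set: "set_pmf (spin_pmf \<theta>) \<subseteq> {-1, 1}"
  by (auto simp: spin_pmf_def)

lemma measure_coin: "measure (measure_pmf coin_pmf) F = (of_bool (1 \<in> F) + of_bool (-1 \<in> F)) / 2"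
proof -
  have "measure (measure_pmf coin_pmf) F = real (card ({-1, 1} \<inter> F)) / 2"
    unfolding coin_pmf_def by (subst measure_pmf_of_set) auto
  also have "\<dots> = (of_bool (1 \<in> F) + of_bool (-1 \<in> F)) / 2"
    by (cases "1 \<in> F"; cases "-1 \<in> F") (auto simp: Int_insert_left)
  finally show ?thesis .
qed

lemma coin_minus: "map_pmf uminus coin_pmf = coin_pmf"
  unfolding coin_pmf_def by (subst map_pmf_of_set_inj) (auto simp: insert_commute)

text \<open>
  Multiplying each coin by a sign that depends only on the initial spins and on earlier coins does
  not change the law: flipping the coin \<open>(v, t)\<close> preserves the measure and affects no other coordinate
  of level at most \<open>Suc t\<close>.
\<close>

definition adapted_coins ::
  "nat list set \<Rightarrow> (nat \<Rightarrow> nat list \<Rightarrow> sample \<Rightarrow> int) \<Rightarrow> sample \<Rightarrow> nat list \<times> nat \<Rightarrow> int" where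
  "adapted_coins V g \<omega> = (\<lambda>p\<in>V \<times> UNIV. case snd p of 0 \<Rightarrow> fst \<omega> (fst p)
     | Suc t \<Rightarrow> snd \<omega> (fst p, t) * g t (fst p) \<omega>)"

lemma measurable_fst_sample: "v \<in> V \<Longrightarrow> (\<lambda>\<omega>. fst \<omega> v) \<in> measurable (sample_space \<theta> V) (count_space UNIV)"
  unfolding sample_space_def
  by (rule measurable_compose[OF measurable_fst])
     (use measurable_component_singleton[of v V "\<lambda>_. measure_pmf (spin_pmf \<theta>)"] in simp)

lemma measurable_snd_sample: "v \<in> V \<Longrightarrow> (\<lambda>\<omega>. snd \<omega> (v, t)) \<in> measurable (sample_space \<theta> V) (count_space UNIV)"
  unfolding sample_space_def
  by (rule measurable_compose[OF measurable_snd])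
     (use measurable_component_singleton[of "(v, t)" "V \<times> UNIV" "\<lambda>_. measure_pmf coin_pmf"] in simp)

lemma pair_sample:
  "pair_prob_space (PiM V (\<lambda>_. measure_pmf (spin_pmf \<theta>))) (PiM (V \<times> UNIV) (\<lambda>_. measure_pmf coin_pmf))"
  by (simp add: pair_prob_space_def pair_sigma_finite_def prob_space_imp_sigma_finite
      prob_space_PiM measure_pmf.prob_space_axioms)

lemma AE_sample_init:
  assumes v: "v \<in> V"
  shows "AE \<omega> in sample_space \<theta> V. fst \<omega> v \<in> {-1, 1}"
proof -
  interpret pair_prob_space "PiM V (\<lambda>_. measure_pmf (spin_pmf \<theta>))" "PiM (V \<times> (UNIV :: nat set)) (\<lambda>_. measure_pmf coin_pmf)"
    by (rule pair_sample)
  have "AE x in PiM V (\<lambda>_. measure_pmf (spin_pmf \<theta>)). x v \<in> {-1, 1}"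
    using v spin_set by (intro AE_PiM_component measure_pmf.prob_space_axioms) (auto simp: AE_measure_pmf_iff)
  moreover have "{\<omega> \<in> space (sample_space \<theta> V). fst \<omega> v \<in> {-1, 1}} \<in> sets (sample_space \<theta> V)"
    by (rule sets_Collect_discrete[OF measurable_fst_sample[OF v]])
  ultimately show ?thesis unfolding sample_space_def
    by (intro AE_pair_measure) auto
qed

lemma AE_sample_coin:
  assumes v: "v \<in> V"
  shows "AE \<omega> in sample_space \<theta> V. snd \<omega> (v, t) \<in> {-1, 1}"
proof -
  interpret pair_prob_space "PiM V (\<lambda>_. measure_pmf (spin_pmf \<theta>))" "PiM (V \<times> (UNIV :: nat set)) (\<lambda>_. measure_pmf coin_pmf)"
    by (rule pair_sample)
  have "AE x in PiM (V \<times> UNIV) (\<lambda>_. measure_pmf coin_pmf). x (v, t) \<in> {-1, 1}"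
    using v by (intro AE_PiM_component measure_pmf.prob_space_axioms) (auto simp: AE_measure_pmf_iff coin_set)
  moreover have "{\<omega> \<in> space (sample_space \<theta> V). snd \<omega> (v, t) \<in> {-1, 1}} \<in> sets (sample_space \<theta> V)"
    by (rule sets_Collect_discrete[OF measurable_snd_sample[OF v]])
  ultimately show ?thesis unfolding sample_space_def
    by (intro AE_pair_measure) auto
qed

definition flip :: "nat list set \<Rightarrow> nat list \<times> nat \<Rightarrow> sample \<Rightarrow> sample" where
  "flip V p \<omega> = (fst \<omega>, \<lambda>q\<in>V \<times> UNIV. if q = p then - snd \<omega> q else snd \<omega> q)"

lemma measurable_flip: "flip V p \<in> measurable (sample_space \<theta> V) (sample_space \<theta> V)"
proof -
  have "(\<lambda>\<omega>. \<lambda>q\<in>V \<times> UNIV. if q = p then - snd \<omega> q else snd \<omega> q)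
      \<in> measurable (sample_space \<theta> V) (PiM (V \<times> UNIV) (\<lambda>_. measure_pmf coin_pmf))"
    by (intro measurable_restrict) (use measurable_snd_sample in auto)
  then show ?thesis unfolding flip_def sample_space_def
    by (intro measurable_Pair) auto
qed

lemma distr_flip: "distr (sample_space \<theta> V) (sample_space \<theta> V) (flip V p) = sample_space \<theta> V"
proof -
  let ?P = "PiM V (\<lambda>_. measure_pmf (spin_pmf \<theta>))"
  let ?C = "PiM (V \<times> (UNIV :: nat set)) (\<lambda>_. measure_pmf coin_pmf)"
  let ?h = "\<lambda>q. if q = p then uminus else (\<lambda>x::int. x)"
  let ?f = "\<lambda>c. \<lambda>q\<in>V \<times> UNIV. ?h q (c q)"
  have d: "distr ?C ?C ?f = PiM (V \<times> UNIV) (\<lambda>q. distr (measure_pmf coin_pmf) (measure_pmf coin_pmf) (?h q))"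
    by (rule distr_PiM_map) (auto intro: measure_pmf.prob_space_axioms)
  have u: "distr (measure_pmf coin_pmf) (measure_pmf coin_pmf) uminus = measure_pmf coin_pmf"
    using coin_minus by (metis map_pmf_rep_eq distr_cong sets_measure_pmf_count_space)
  have i: "distr (measure_pmf coin_pmf) (measure_pmf coin_pmf) (\<lambda>x. x) = measure_pmf coin_pmf"
    by (rule distr_id)
  have "distr (measure_pmf coin_pmf) (measure_pmf coin_pmf) (?h q) = measure_pmf coin_pmf" for q
    using u i by (cases "q = p") simp_all
  with d have dC: "distr ?C ?C ?f = ?C" by simp
  have f: "?f \<in> measurable ?C ?C"
  proof (rule measurable_restrict)
    fix q :: "nat list \<times> nat" assume "q \<in> V \<times> UNIV"
    then show "(\<lambda>c. ?h q (c q)) \<in> measurable ?C (measure_pmf coin_pmf)"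
      by (intro measurable_compose[OF measurable_component_singleton[of q]]) auto
  qed
  have C: "sigma_finite_measure ?C"
    by (intro prob_space_imp_sigma_finite prob_space_PiM measure_pmf.prob_space_axioms)
  have "sample_space \<theta> V = distr ?P ?P (\<lambda>x. x) \<Otimes>\<^sub>M distr ?C ?C ?f"
    unfolding sample_space_def dC by (simp add: distr_id)
  also have "\<dots> = distr (?P \<Otimes>\<^sub>M ?C) (?P \<Otimes>\<^sub>M ?C) (\<lambda>(x, y). (x, ?f y))"
    by (rule pair_measure_distr) (use f C dC in auto)
  also have "(\<lambda>(x, y). (x, ?f y)) = flip V p"
    by (auto simp: flip_def fun_eq_iff)
  finally show ?thesis by (simp add: sample_space_def)
qed

lemma measurable_adapted_coins:
  assumes g: "\<And>t v. v \<in> V \<Longrightarrow> g t v \<in> measurable (sample_space \<theta> V) (count_space UNIV)"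
  shows "adapted_coins V g \<in> measurable (sample_space \<theta> V) (law \<theta> V)"
  unfolding adapted_coins_def law_def
proof (rule measurable_restrict)
  fix p :: "nat list \<times> nat" assume p: "p \<in> V \<times> UNIV"
  then have v: "fst p \<in> V" by auto
  note [measurable] = measurable_fst_sample[OF v] measurable_snd_sample[OF v] g[OF v]
  show "(\<lambda>\<omega>. case snd p of 0 \<Rightarrow> fst \<omega> (fst p) | Suc t \<Rightarrow> snd \<omega> (fst p, t) * g t (fst p) \<omega>)
      \<in> measurable (sample_space \<theta> V) (site \<theta> p)"
    unfolding measurable_site by (cases "snd p") simp_all
qed

lemma distr_adapted_coins:
  assumes g: "\<And>t v. v \<in> V \<Longrightarrow> g t v \<in> measurable (sample_space \<theta> V) (count_space UNIV)"
    and val: "\<And>t v. v \<in> V \<Longrightarrow> AE \<omega> in sample_space \<theta> V. g t v \<omega> \<in> {-1, 1}"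
    and adapted: "\<And>t s v w \<omega>. v \<in> V \<Longrightarrow> t \<le> s \<Longrightarrow> \<omega> \<in> space (sample_space \<theta> V) \<Longrightarrow>
        g t v (flip V (w, s) \<omega>) = g t v \<omega>"
  shows "distr (sample_space \<theta> V) (law \<theta> V) (adapted_coins V g) = law \<theta> V"
proof -
  let ?M = "sample_space \<theta> V" and ?h = "adapted_coins V g"
  interpret M: prob_space ?M by (rule prob_space_sample)
  have h[measurable]: "?h \<in> measurable ?M (law \<theta> V)"
    by (rule measurable_adapted_coins[OF g])
  have hp[measurable]: "(\<lambda>\<omega>. ?h \<omega> p) \<in> measurable ?M (count_space UNIV)" if "p \<in> V \<times> UNIV" for p
    using measurable_compose[OF h[unfolded law_def] measurable_component_singleton[OF that]]
    by (simp add: measurable_site)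
  have sets: "{\<omega> \<in> space ?M. \<forall>q\<in>J. ?h \<omega> q \<in> F q} \<in> sets ?M" if "finite J" "J \<subseteq> V \<times> UNIV" for J F
  proof -
    have "{\<omega> \<in> space ?M. ?h \<omega> q \<in> F q} \<in> sets ?M" if "q \<in> J" for q
      using that \<open>J \<subseteq> _\<close> by (intro sets_Collect_discrete hp) auto
    then show ?thesis using \<open>finite J\<close> by (intro sets.sets_Collect_finite_All) auto
  qed
  \<comment> \<open>The induction adds coordinates in order of level. Flipping the coin of the
    newest one negates it and leaves all earlier ones alone, so it is a fair sign independent of
    them.\<close>
  have key: "M.prob {\<omega> \<in> space ?M. \<forall>q\<in>J. ?h \<omega> q \<in> F q} = (\<Prod>q\<in>J. measure (site \<theta> q) (F q))"
    if "finite J" "J \<subseteq> V \<times> UNIV" for J F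
    using that
  proof (induction J rule: finite_ranking_induct[where f = snd])
    case empty
    then show ?case by (simp add: M.prob_space)
  next
    case (insert p J)
    obtain v n where p: "p = (v, n)" by (cases p)
    have v: "v \<in> V" using insert.prems p by auto
    \<comment> \<open>The ranked induction does not supply \<open>p \<notin> J\<close>, hence the
      first case.\<close>
    consider "p \<in> J" | "p \<notin> J" "n = 0" | t where "p \<notin> J" "n = Suc t"
      by (cases n) auto
    then show ?case
    proof cases
      case 1
      then show ?thesis using insert by (simp add: insert_absorb)
    next
      case 2
      note 0 = 2(2)
      let ?P = "PiM V (\<lambda>_. measure_pmf (spin_pmf \<theta>))"
      let ?C = "PiM (V \<times> (UNIV :: nat set)) (\<lambda>_. measure_pmf coin_pmf)"
      interpret C: prob_space ?C by (intro prob_space_PiM measure_pmf.prob_space_axioms)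
      define I where "I = fst ` insert p J"
      \<comment> \<open>Since \<open>p\<close> has maximal level, level 0 for \<open>p\<close> means
        that only initial spins occur, and the event is a cylinder over the first factor of the
        sample space.\<close>
      have J0: "snd q = 0" if "q \<in> insert p J" for q using insert.hyps(2) that p 0 by (cases q) auto
      have "(\<lambda>w. (w, 0)) ` I = (\<lambda>q. (fst q, 0)) ` insert p J"
        by (simp only: I_def image_image)
      also have "\<dots> = (\<lambda>q. q) ` insert p J"
        using J0 by (intro image_cong refl) (simp only: prod_eq_iff fst_conv snd_conv simp_thms)
      finally have IJ: "insert p J = (\<lambda>w. (w, 0)) ` I" by simp
      have I: "I \<subseteq> V" "finite I" using insert.prems insert.hyps by (auto simp: I_def)
      have h0: "?h \<omega> (w, 0) = fst \<omega> w" if "w \<in> I" for w \<omega>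
        using I(1) that by (auto simp: adapted_coins_def)
      have "{\<omega> \<in> space ?M. \<forall>q\<in>insert p J. ?h \<omega> q \<in> F q}
          = prod_emb V (\<lambda>_. measure_pmf (spin_pmf \<theta>)) I (\<Pi>\<^sub>E w\<in>I. F (w, 0)) \<times> space ?C"
        unfolding IJ using I h0
        by (auto simp: sample_space_def space_pair_measure prod_emb_def space_PiM PiE_iff)
      moreover have "emeasure ?M \<dots> = (\<Prod>w\<in>I. emeasure (spin_pmf \<theta>) (F (w, 0)))"
        unfolding sample_space_def using I
        by (subst C.emeasure_pair_measure_Times)
          (auto intro!: sets_PiM_I simp: C.emeasure_space_1 emeasure_PiM_emb measure_pmf.prob_space_axioms)
      moreover have "\<dots> = ennreal (\<Prod>q\<in>insert p J. measure (site \<theta> q) (F q))"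
        unfolding IJ by (subst prod.reindex) (auto simp: inj_on_def site_def measure_pmf.emeasure_eq_measure prod_ennreal)
      ultimately show ?thesis
        by (simp add: M.emeasure_eq_measure prod_nonneg measure_nonneg del: insert_iff ball_simps prod.insert)
    next
      case (3 t)
      note Suc = 3(2)
      define A where "A = {\<omega> \<in> space ?M. \<forall>q\<in>J. ?h \<omega> q \<in> F q}"
      have J: "J \<subseteq> V \<times> UNIV" using insert.prems by auto
      have A[measurable]: "A \<in> sets ?M" unfolding A_def by (rule sets[OF insert.hyps(1) J])
      define B where "B a = {\<omega> \<in> A. ?h \<omega> p = a}" for a
      have pV: "p \<in> V \<times> UNIV" using v p by auto
      have B[measurable]: "B a \<in> sets ?M" for a
      proof -
        have "B a = A \<inter> {\<omega> \<in> space ?M. ?h \<omega> p = a}"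
          unfolding B_def A_def by auto
        also have "\<dots> \<in> sets ?M" by (intro sets.Int A sets_Collect_discrete hp pV)
        finally show ?thesis .
      qed
      let ?fl = "flip V (v, t)"
      have fsp: "?fl \<omega> \<in> space ?M" if "\<omega> \<in> space ?M" for \<omega>
        using measurable_space[OF measurable_flip that] .
      have hq: "?h (?fl \<omega>) q = ?h \<omega> q" if q: "q \<in> J" and \<omega>: "\<omega> \<in> space ?M" for q \<omega>
      proof -
        have "q \<noteq> p" "snd q \<le> Suc t" "fst q \<in> V" using q insert.hyps J p Suc 3(1) by auto
        then show ?thesis using adapted[of "fst q" _ t \<omega> v] \<omega> p Suc
          by (cases q) (auto simp: adapted_coins_def flip_def[of V "(v, t)" \<omega>] split: nat.split)
      qed
      have hpm: "?h (?fl \<omega>) p = - ?h \<omega> p" if \<omega>: "\<omega> \<in> space ?M" for \<omega>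
        using adapted[of v t t \<omega> v] \<omega> p Suc v by (auto simp: adapted_coins_def flip_def)
      \<comment> \<open>The flip preserves the measure and exchanges \<open>B 1\<close> with
        \<open>B (- 1)\<close>.\<close>
      have "M.prob (B 1) = measure (distr ?M ?M ?fl) (B 1)" by (simp add: distr_flip)
      also have "\<dots> = M.prob (?fl -` B 1 \<inter> space ?M)"
        by (rule measure_distr[OF measurable_flip B])
      also have "?fl -` B 1 \<inter> space ?M = B (- 1)"
        using fsp by (auto simp: B_def A_def hq hpm)
      finally have eq: "M.prob (B 1) = M.prob (B (- 1))" .
      have ae: "AE \<omega> in ?M. ?h \<omega> p \<in> {-1, 1}"
        using AE_sample_coin[OF v, where \<theta> = \<theta> and t = t] val[OF v, of t]
        by eventually_elim (use p Suc v in \<open>auto simp: adapted_coins_def\<close>)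
      have split: "M.prob {\<omega> \<in> A. ?h \<omega> p \<in> G} = (of_bool (1 \<in> G) + of_bool (-1 \<in> G)) * M.prob (B 1)" for G
      proof -
        let ?S = "(if 1 \<in> G then B 1 else {}) \<union> (if -1 \<in> G then B (-1) else {})"
        have "{\<omega> \<in> A. ?h \<omega> p \<in> G} = A \<inter> {\<omega> \<in> space ?M. ?h \<omega> p \<in> G}"
          unfolding A_def by auto
        also have "\<dots> \<in> sets ?M" by (intro sets.Int A sets_Collect_discrete hp pV)
        finally have G: "{\<omega> \<in> A. ?h \<omega> p \<in> G} \<in> sets ?M" .
        have if_sets: "(if b then X else {}) \<in> sets ?M" if "X \<in> sets ?M" for b X
          using that by simp
        have S: "?S \<in> sets ?M" by (intro sets.Un if_sets B)
        have "AE \<omega> in ?M. \<omega> \<in> {\<omega> \<in> A. ?h \<omega> p \<in> G} \<longleftrightarrow> \<omega> \<in> ?S"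
          using ae by eventually_elim (auto simp: B_def)
        then have "M.prob {\<omega> \<in> A. ?h \<omega> p \<in> G} = M.prob ?S"
          using G S by (rule M.finite_measure_eq_AE)
        also have "\<dots> = M.prob (if 1 \<in> G then B 1 else {}) + M.prob (if -1 \<in> G then B (-1) else {})"
          by (rule M.finite_measure_Union[OF if_sets[OF B] if_sets[OF B]]) (auto simp: B_def)
        also have "\<dots> = (of_bool (1 \<in> G) + of_bool (-1 \<in> G)) * M.prob (B 1)"
          using eq by auto
        finally show ?thesis .
      qed
      have "M.prob A = 2 * M.prob (B 1)" using split[of UNIV] by simp
      moreover have "measure (site \<theta> p) (F p) = (of_bool (1 \<in> F p) + of_bool (-1 \<in> F p)) / 2"
        using p Suc by (simp add: site_def measure_coin)
      ultimately have eq': "M.prob {\<omega> \<in> A. ?h \<omega> p \<in> F p} = measure (site \<theta> p) (F p) * M.prob A"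
        using split[of "F p"] by simp
      have "{\<omega> \<in> space ?M. \<forall>q\<in>insert p J. ?h \<omega> q \<in> F q} = {\<omega> \<in> A. ?h \<omega> p \<in> F p}"
        by (auto simp: A_def)
      then have "M.prob {\<omega> \<in> space ?M. \<forall>q\<in>insert p J. ?h \<omega> q \<in> F q} = measure (site \<theta> p) (F p) * M.prob A"
        using eq' by (simp only:)
      also have "M.prob A = (\<Prod>q\<in>J. measure (site \<theta> q) (F q))"
        unfolding A_def by (rule insert.IH[OF J])
      also have "measure (site \<theta> p) (F p) * \<dots> = (\<Prod>q\<in>insert p J. measure (site \<theta> q) (F q))"
        by (rule prod.insert[OF insert.hyps(1) 3(1), symmetric])
      finally show ?thesis .
    qed
  qed
  interpret S: product_prob_space "site \<theta>" "V \<times> UNIV"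
    by (intro product_prob_spaceI prob_space_site)
  show ?thesis
    unfolding law_def
  proof (rule S.PiM_eq)
    fix J F assume J: "finite J" "J \<subseteq> V \<times> UNIV" and F: "\<And>j. j \<in> J \<Longrightarrow> F j \<in> sets (site \<theta> j)"
    have "emeasure (distr ?M (PiM (V \<times> UNIV) (site \<theta>)) ?h) (prod_emb (V \<times> UNIV) (site \<theta>) J (Pi\<^sub>E J F))
        = emeasure ?M (?h -` prod_emb (V \<times> UNIV) (site \<theta>) J (Pi\<^sub>E J F) \<inter> space ?M)"
      using h J F by (intro emeasure_distr) (auto simp: law_def intro!: sets_PiM_I)
    also have "?h -` prod_emb (V \<times> UNIV) (site \<theta>) J (Pi\<^sub>E J F) \<inter> space ?M
        = {\<omega> \<in> space ?M. \<forall>q\<in>J. ?h \<omega> q \<in> F q}"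
    proof -
      have "?h \<omega> \<in> extensional (V \<times> UNIV)" for \<omega>
        unfolding adapted_coins_def by (rule restrict_extensional)
      then show ?thesis by (auto simp: prod_emb_iff restrict_PiE_iff)
    qed
    also have "emeasure ?M \<dots> = (\<Prod>j\<in>J. emeasure (site \<theta> j) (F j))"
      using key[OF J, of F]
      by (simp add: M.emeasure_eq_measure site_def measure_pmf.emeasure_eq_measure prod_ennreal)
    finally show "emeasure (distr ?M (PiM (V \<times> UNIV) (site \<theta>)) ?h) (prod_emb (V \<times> UNIV) (site \<theta>) J (Pi\<^sub>E J F))
        = (\<Prod>j\<in>J. emeasure (site \<theta> j) (F j))" .
  qed simp
qed

section \<open>Dynamics with fresh coins\<close>

text \<open>
  \<open>u\<close> is a field acting on the root \<open>[]\<close> only. \<open>w\<close> marks the vertices whose tie rule refers to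
  their own spin: all vertices in \<^const>\<open>majority\<close>, all but the root in \<^const>\<open>field_majority\<close>.
\<close>

primrec sample_dyn ::
  "nat list set \<Rightarrow> (nat \<Rightarrow> int) \<Rightarrow> (nat list \<Rightarrow> bool) \<Rightarrow> sample \<Rightarrow> nat \<Rightarrow> nat list \<Rightarrow> int" where
  "sample_dyn V u w \<omega> 0 i = fst \<omega> i"
| "sample_dyn V u w \<omega> (Suc t) i =
     (let s = (\<Sum>j\<in>nbrs V i. sample_dyn V u w \<omega> t j) + (if i = [] then u t else 0)
      in if s \<noteq> 0 then sgn s else snd \<omega> (i, t) * (if w i then sample_dyn V u w \<omega> t i else 1))"

primrec dyn ::
  "nat list set \<Rightarrow> (nat \<Rightarrow> int) \<Rightarrow> (nat list \<times> nat \<Rightarrow> int) \<Rightarrow> nat \<Rightarrow> nat list \<Rightarrow> int" where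
  "dyn V u f 0 i = f (i, 0)"
| "dyn V u f (Suc t) i =
     (let s = (\<Sum>j\<in>nbrs V i. dyn V u f t j) + (if i = [] then u t else 0)
      in if s \<noteq> 0 then sgn s else f (i, Suc t))"

lemma majority_eq_sample_dyn: "majority V \<omega> t i = sample_dyn V (\<lambda>_. 0) (\<lambda>_. True) \<omega> t i"
  by (induction t arbitrary: i) auto

lemma field_majority_eq_sample_dyn:
  "field_majority k u \<omega> t i = sample_dyn (rooted_tree k) u (\<lambda>i. i \<noteq> []) \<omega> t i"
  by (induction t arbitrary: i) auto

lemma measurable_int_sum:
  fixes F :: "'a \<Rightarrow> 'b \<Rightarrow> int"
  assumes "\<And>j. j \<in> J \<Longrightarrow> F j \<in> measurable M (count_space UNIV)"
  shows "(\<lambda>\<omega>. \<Sum>j\<in>J. F j \<omega>) \<in> measurable M (count_space UNIV)"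
  using assms
proof (induction J rule: infinite_finite_induct)
  case (insert x J)
  then have [measurable]: "F x \<in> measurable M (count_space UNIV)"
    "(\<lambda>\<omega>. \<Sum>j\<in>J. F j \<omega>) \<in> measurable M (count_space UNIV)" by auto
  show ?case using insert.hyps by simp
qed simp_all

lemma nbrs_subset: "nbrs V i \<subseteq> V"
  by (auto simp: nbrs_def)

lemma measurable_sample_dyn:
  "v \<in> V \<Longrightarrow> (\<lambda>\<omega>. sample_dyn V u w \<omega> t v) \<in> measurable (sample_space \<theta> V) (count_space UNIV)"
proof (induction t arbitrary: v)
  case 0
  then show ?case by (simp add: measurable_fst_sample)
next
  case (Suc t)
  have [measurable]: "(\<lambda>\<omega>. \<Sum>j\<in>nbrs V v. sample_dyn V u w \<omega> t j) \<in> measurable (sample_space \<theta> V) (count_space UNIV)"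
    using Suc.IH nbrs_subset by (intro measurable_int_sum) blast
  note [measurable] = Suc.IH[OF Suc.prems] measurable_snd_sample[OF Suc.prems]
  define c where "c = (if v = [] then u t else 0)"
  define b where "b = w v"
  have eq: "sample_dyn V u w \<omega> (Suc t) v = (let s = (\<Sum>j\<in>nbrs V v. sample_dyn V u w \<omega> t j) + c
    in if s \<noteq> 0 then sgn s else snd \<omega> (v, t) * (if b then sample_dyn V u w \<omega> t v else 1))" for \<omega>
    by (simp add: c_def b_def)
  show ?case unfolding eq Let_def by measurable
qed

lemma AE_sample_dyn:
  assumes "v \<in> V" shows "AE \<omega> in sample_space \<theta> V. sample_dyn V u w \<omega> t v \<in> {-1, 1}"
  using assms
proof (induction t arbitrary: v)
  case 0
  then show ?case using AE_sample_init by simp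
next
  case (Suc t)
  show ?case using AE_sample_coin[OF Suc.prems, where \<theta> = \<theta> and t = t] Suc.IH[OF Suc.prems]
    by eventually_elim (auto simp: Let_def sgn_if)
qed

text \<open>The coin \<open>(x, s)\<close> is first read in the update to time \<open>Suc s\<close>.
  This is the adaptedness required of the sign by which a coin is multiplied.\<close>

lemma sample_dyn_flip:
  "v \<in> V \<Longrightarrow> t \<le> s \<Longrightarrow> sample_dyn V u w (flip V (x, s) \<omega>) t v = sample_dyn V u w \<omega> t v"
proof (induction t arbitrary: v)
  case 0
  then show ?case by (simp add: flip_def)
next
  case (Suc t)
  then have "(\<Sum>j\<in>nbrs V v. sample_dyn V u w (flip V (x, s) \<omega>) t j) = (\<Sum>j\<in>nbrs V v. sample_dyn V u w \<omega> t j)"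
    using nbrs_subset by (intro sum.cong) auto
  moreover have "snd (flip V (x, s) \<omega>) (v, t) = snd \<omega> (v, t)"
    using Suc.prems by (simp add: flip_def)
  ultimately show ?case using Suc.prems Suc.IH[OF Suc.prems(1)] by (simp add: Let_def)
qed

text \<open>In a tie the keep-or-flip rule returns coin times own spin. Taking this product as the
  new coordinate makes the update independent of the own spin, path by path.\<close>

definition fresh_coins ::
  "nat list set \<Rightarrow> (nat \<Rightarrow> int) \<Rightarrow> (nat list \<Rightarrow> bool) \<Rightarrow> sample \<Rightarrow> nat list \<times> nat \<Rightarrow> int" where
  "fresh_coins V u w = adapted_coins V (\<lambda>t v \<omega>. if w v then sample_dyn V u w \<omega> t v else 1)"

lemma measurable_fresh_coins: "fresh_coins V u w \<in> measurable (sample_space \<theta> V) (law \<theta> V)"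
  unfolding fresh_coins_def
proof (rule measurable_adapted_coins)
  fix t v assume "v \<in> V"
  then show "(\<lambda>\<omega>. if w v then sample_dyn V u w \<omega> t v else 1) \<in> measurable (sample_space \<theta> V) (count_space UNIV)"
    by (cases "w v") (simp_all add: measurable_sample_dyn)
qed

lemma distr_fresh_coins:
  "distr (sample_space \<theta> V) (law \<theta> V) (fresh_coins V u w) = law \<theta> V"
  unfolding fresh_coins_def
proof (rule distr_adapted_coins)
  fix t v assume v: "v \<in> V"
  show "(\<lambda>\<omega>. if w v then sample_dyn V u w \<omega> t v else 1) \<in> measurable (sample_space \<theta> V) (count_space UNIV)"
    using v by (cases "w v") (simp_all add: measurable_sample_dyn)
  show "AE \<omega> in sample_space \<theta> V. (if w v then sample_dyn V u w \<omega> t v else 1) \<in> {-1, 1}"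
    using AE_sample_dyn[OF v, of u w] by eventually_elim auto
qed (simp add: sample_dyn_flip)

lemma dyn_fresh_coins:
  "v \<in> V \<Longrightarrow> dyn V u (fresh_coins V u w \<omega>) t v = sample_dyn V u w \<omega> t v"
proof (induction t arbitrary: v)
  case 0
  then show ?case by (simp add: fresh_coins_def adapted_coins_def)
next
  case (Suc t)
  then have "(\<Sum>j\<in>nbrs V v. dyn V u (fresh_coins V u w \<omega>) t j) = (\<Sum>j\<in>nbrs V v. sample_dyn V u w \<omega> t j)"
    using nbrs_subset by (intro sum.cong) auto
  moreover have "fresh_coins V u w \<omega> (v, Suc t) = snd \<omega> (v, t) * (if w v then sample_dyn V u w \<omega> t v else 1)"
    using Suc.prems by (simp add: fresh_coins_def adapted_coins_def)
  ultimately show ?case by (simp add: Let_def)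
qed

lemma measurable_law_component: "p \<in> V \<times> UNIV \<Longrightarrow> (\<lambda>f. f p) \<in> measurable (law \<theta> V) (count_space UNIV)"
  using measurable_component_singleton[of p "V \<times> UNIV" "site \<theta>"]
  by (simp add: law_def measurable_site)

lemma measurable_dyn:
  "v \<in> V \<Longrightarrow> (\<lambda>f. dyn V u f t v) \<in> measurable (law \<theta> V) (count_space UNIV)"
proof (induction t arbitrary: v)
  case 0
  then show ?case by (simp add: measurable_law_component)
next
  case (Suc t)
  have S: "(\<lambda>f. \<Sum>j\<in>nbrs V v. dyn V u f t j) \<in> measurable (law \<theta> V) (count_space UNIV)"
    using Suc.IH nbrs_subset by (intro measurable_int_sum) blast
  have f: "(\<lambda>f. f (v, Suc t)) \<in> measurable (law \<theta> V) (count_space UNIV)"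
    using Suc.prems by (simp add: measurable_law_component)
  define c where "c = (if v = [] then u t else 0)"
  have eq: "dyn V u f (Suc t) v = (let s = (\<Sum>j\<in>nbrs V v. dyn V u f t j) + c in if s \<noteq> 0 then sgn s else f (v, Suc t))" for f
    by (simp add: c_def)
  show ?case unfolding eq Let_def
    by (rule measurable_If[OF measurable_compose[OF S, of "\<lambda>s. sgn (s + c)"] f
          sets_Collect_discrete[OF S, of "\<lambda>s. s + c \<noteq> 0"]]) simp
qed

lemma measure_law_eq_sample:
  assumes "{f \<in> space (law \<theta> V). P f} \<in> sets (law \<theta> V)"
  shows "\<P>(f in law \<theta> V. P f) = \<P>(\<omega> in sample_space \<theta> V. P (fresh_coins V u w \<omega>))"
proof -
  have "\<P>(f in law \<theta> V. P f) = measure (distr (sample_space \<theta> V) (law \<theta> V) (fresh_coins V u w)) {f \<in> space (law \<theta> V). P f}"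
    by (simp add: distr_fresh_coins)
  also have "\<dots> = measure (sample_space \<theta> V) (fresh_coins V u w -` {f \<in> space (law \<theta> V). P f} \<inter> space (sample_space \<theta> V))"
    by (rule measure_distr[OF measurable_fresh_coins assms])
  also have "fresh_coins V u w -` {f \<in> space (law \<theta> V). P f} \<inter> space (sample_space \<theta> V)
      = {\<omega> \<in> space (sample_space \<theta> V). P (fresh_coins V u w \<omega>)}"
    using measurable_space[OF measurable_fresh_coins[of V u w \<theta>]] by blast
  finally show ?thesis .
qed

section \<open>The consensus event; monotonicity and sign symmetry of the fresh-coin
  dynamics\<close>

definition consensus :: "nat list set \<Rightarrow> (nat list \<times> nat \<Rightarrow> int) \<Rightarrow> bool" where
  "consensus V f \<longleftrightarrow> (\<forall>i\<in>V. (\<lambda>t. dyn V (\<lambda>_. 0) f t i) \<longlonglongrightarrow> 1)"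

lemma int_tendsto_iff: "(X :: nat \<Rightarrow> int) \<longlonglongrightarrow> a \<longleftrightarrow> (\<exists>N. \<forall>n\<ge>N. X n = a)"
  by (simp add: tendsto_discrete eventually_sequentially)

lemma measurable_consensus: "{f \<in> space (law \<theta> V). consensus V f} \<in> sets (law \<theta> V)"
proof -
  have *: "{f \<in> space (law \<theta> V). \<exists>N. \<forall>n\<ge>N. dyn V (\<lambda>_. 0) f n i = 1} \<in> sets (law \<theta> V)" if "i \<in> V" for i
  proof (rule sets.sets_Collect_countable_Ex, rule sets.sets_Collect_countable_All)
    fix N n :: nat
    show "{f \<in> space (law \<theta> V). n \<ge> N \<longrightarrow> dyn V (\<lambda>_. 0) f n i = 1} \<in> sets (law \<theta> V)"
      by (rule sets_Collect_discrete[OF measurable_dyn[OF that], where P = "\<lambda>a. n \<ge> N \<longrightarrow> a = 1"])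
  qed
  have "{f \<in> space (law \<theta> V). \<forall>i. i \<in> V \<longrightarrow> (\<exists>N. \<forall>n\<ge>N. dyn V (\<lambda>_. 0) f n i = 1)} \<in> sets (law \<theta> V)"
  proof (rule sets.sets_Collect_countable_All)
    fix i show "{f \<in> space (law \<theta> V). i \<in> V \<longrightarrow> (\<exists>N. \<forall>n\<ge>N. dyn V (\<lambda>_. 0) f n i = 1)} \<in> sets (law \<theta> V)"
    proof (cases "i \<in> V")
      case True
      with *[OF True] show ?thesis by (simp only: simp_thms)
    next
      case False
      then show ?thesis using sets.sets_Collect_const[of "law \<theta> V" True] by (simp only: simp_thms)
    qed
  qed
  then show ?thesis unfolding consensus_def int_tendsto_iff Ball_def .
qed

text \<open>Translates the condition in \<open>theta_star\<close> to fresh coins, where couplings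
  are available.\<close>

lemma prob_majority_consensus:
  "\<P>(\<omega> in sample_space \<theta> V. \<forall>i\<in>V. (\<lambda>t. majority V \<omega> t i) \<longlonglongrightarrow> 1) = 1
    \<longleftrightarrow> (AE f in law \<theta> V. consensus V f)"
proof -
  interpret prob_space "law \<theta> V" by (rule prob_space_law)
  have "\<P>(\<omega> in sample_space \<theta> V. \<forall>i\<in>V. (\<lambda>t. majority V \<omega> t i) \<longlonglongrightarrow> 1)
      = \<P>(\<omega> in sample_space \<theta> V. consensus V (fresh_coins V (\<lambda>_. 0) (\<lambda>_. True) \<omega>))"
    by (simp add: consensus_def dyn_fresh_coins majority_eq_sample_dyn)
  also have "\<dots> = \<P>(f in law \<theta> V. consensus V f)"
    by (rule measure_law_eq_sample[OF measurable_consensus, symmetric])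
  finally show ?thesis
    using prob_Collect_eq_1[OF measurable_consensus] by simp
qed

lemma AE_law_values:
  "AE f in law \<theta> V. \<forall>p\<in>V \<times> UNIV. f p \<in> {-1, 1}"
proof (rule AE_ball_countable[THEN iffD2, OF _ ballI])
  fix p :: "nat list \<times> nat" assume p: "p \<in> V \<times> UNIV"
  have "AE x in site \<theta> p. x \<in> {-1, 1}"
    using spin_set[of \<theta>] unfolding site_def by (cases "snd p") (auto simp: AE_measure_pmf_iff coin_set)
  then show "AE f in law \<theta> V. f p \<in> {-1, 1}"
    unfolding law_def by (intro AE_PiM_component prob_space_site p)
qed simp

lemma dyn_values:
  assumes "\<forall>p\<in>V \<times> UNIV. f p \<in> {-1, 1}" and "v \<in> V"
  shows "dyn V u f t v \<in> {-1, 1}"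
proof (cases t)
  case (Suc s)
  then show ?thesis using bspec[OF assms(1), of "(v, Suc s)"] assms(2) by (auto simp: Let_def sgn_if)
qed (use assms in auto)

text \<open>A larger sum has a larger sign. If just one of the two sums vanishes, the other spin is
  already the extreme value on the correct side; if both vanish, the coordinates themselves are
  compared.\<close>

lemma dyn_mono:
  assumes f: "\<forall>p\<in>V \<times> UNIV. f p \<in> {-1, 1}" and g: "\<forall>p\<in>V \<times> UNIV. g p \<in> {-1, 1}"
    and fg: "\<forall>p\<in>V \<times> UNIV. f p \<le> g p" and "v \<in> V"
  shows "dyn V u f t v \<le> dyn V u g t v"
  using \<open>v \<in> V\<close>
proof (induction t arbitrary: v)
  case 0
  then show ?case using fg by auto
next
  case (Suc t)
  let ?c = "if v = [] then u t else 0"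
  define a b where "a = (\<Sum>j\<in>nbrs V v. dyn V u f t j) + ?c" and "b = (\<Sum>j\<in>nbrs V v. dyn V u g t j) + ?c"
  have "a \<le> b" unfolding a_def b_def
    using Suc.IH nbrs_subset by (intro add_right_mono sum_mono) blast
  moreover have "f (v, Suc t) \<in> {-1, 1}" "g (v, Suc t) \<in> {-1, 1}" "f (v, Suc t) \<le> g (v, Suc t)"
    using f g fg Suc.prems by blast+
  moreover have "dyn V u f (Suc t) v = (if a \<noteq> 0 then sgn a else f (v, Suc t))"
    "dyn V u g (Suc t) v = (if b \<noteq> 0 then sgn b else g (v, Suc t))"
    by (simp_all add: a_def b_def Let_def)
  ultimately show ?case by (auto simp: sgn_if)
qed

lemma dyn_uminus:
  assumes g: "\<And>p. p \<in> V \<times> UNIV \<Longrightarrow> g p = - f p"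
  shows "v \<in> V \<Longrightarrow> dyn V (\<lambda>_. 0) g t v = - dyn V (\<lambda>_. 0) f t v"
proof (induction t arbitrary: v)
  case 0
  then show ?case using g by simp
next
  case (Suc t)
  have "(\<Sum>j\<in>nbrs V v. dyn V (\<lambda>_. 0) g t j) = (\<Sum>j\<in>nbrs V v. - dyn V (\<lambda>_. 0) f t j)"
    using nbrs_subset by (intro sum.cong refl Suc.IH) blast
  then show ?case using Suc.prems g by (simp add: Let_def sum_negf sgn_minus)
qed

section \<open>Monotonicity in the parameter\<close>

lemma spin_coupling:
  assumes "-1 \<le> \<theta>" "\<theta> \<le> \<theta>'" "\<theta>' \<le> 1"
  obtains q :: "(int \<times> int) pmf"
  where "map_pmf fst q = spin_pmf \<theta>" "map_pmf snd q = spin_pmf \<theta>'" "\<And>a b. (a, b) \<in> set_pmf q \<Longrightarrow> a \<le> b"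
proof -
  define p p' where "p = (1 + \<theta>) / 2" and "p' = (1 + \<theta>') / 2"
  have p: "0 \<le> p" "p \<le> p'" "p' \<le> 1" using assms by (auto simp: p_def p'_def)
  \<comment> \<open>\<open>r\<close> is the probability of raising a \<open>- 1\<close> to
    \<open>1\<close>, determined by \<open>(1 - p) * (1 - r) = 1 - p'\<close>. For
    \<open>p = 1\<close> division by zero gives \<open>r = 0\<close>, which is consistent because
    then \<open>p' = 1\<close>.\<close>
  define r where "r = (p' - p) / (1 - p)"
  have r: "0 \<le> r" "r \<le> 1" using p by (auto simp: r_def divide_simps)
  let ?B = "pair_pmf (bernoulli_pmf p) (bernoulli_pmf r)"
  let ?s = "\<lambda>b. if b then 1 else - 1 :: int"
  have "pmf (map_pmf (\<lambda>(a, c). a \<or> c) ?B) False = pmf (bernoulli_pmf p') False"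
  proof -
    have "(\<lambda>(a, c). a \<or> c) -` {False} = {(False, False)}" by auto
    then have "pmf (map_pmf (\<lambda>(a, c). a \<or> c) ?B) False = pmf ?B (False, False)"
      by (simp add: pmf_map measure_pmf_single)
    also have "\<dots> = (1 - p) * (1 - r)" using p r by (simp add: pmf_pair)
    also have "\<dots> = 1 - p'" using p by (cases "p = 1") (auto simp: r_def field_simps)
    finally show ?thesis using p by simp
  qed
  note F = this
  have or: "map_pmf (\<lambda>(a, c). a \<or> c) ?B = bernoulli_pmf p'"
  proof (intro pmf_eqI)
    show "pmf (map_pmf (\<lambda>(a, c). a \<or> c) ?B) b = pmf (bernoulli_pmf p') b" for b
      using F by (cases b) (simp_all only: pmf_True_conv_False)
  qed
  let ?q = "map_pmf (\<lambda>(a, c). (?s a, ?s (a \<or> c))) ?B"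
  show ?thesis
  proof
    have "map_pmf fst ?q = map_pmf ?s (map_pmf fst ?B)"
      by (simp add: pmf.map_comp comp_def case_prod_unfold)
    then show "map_pmf fst ?q = spin_pmf \<theta>" by (simp add: map_fst_pair_pmf spin_pmf_def p_def)
    have "map_pmf snd ?q = map_pmf ?s (map_pmf (\<lambda>(a, c). a \<or> c) ?B)"
      by (simp add: pmf.map_comp comp_def case_prod_unfold)
    then show "map_pmf snd ?q = spin_pmf \<theta>'" by (simp add: or spin_pmf_def p'_def)
    show "a \<le> b" if "(a, b) \<in> set_pmf ?q" for a b using that by auto
  qed
qed

text \<open>Serves two purposes: with the projections it yields the marginals of a coupling, with
  negation the symmetry at parameter 0.\<close>

lemma distr_law_map:
  assumes "\<And>p. map_pmf h (q p) = (if snd p = 0 then spin_pmf \<theta> else coin_pmf)"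
  shows "distr (PiM (V \<times> UNIV) (\<lambda>p. measure_pmf (q p))) (law \<theta> V) (\<lambda>k. \<lambda>p\<in>V \<times> UNIV. h (k p)) = law \<theta> V"
    and "(\<lambda>k. \<lambda>p\<in>V \<times> UNIV. h (k p)) \<in> measurable (PiM (V \<times> UNIV) (\<lambda>p. measure_pmf (q p))) (law \<theta> V)"
proof -
  have "distr (measure_pmf (q p)) (site \<theta> p) h = site \<theta> p" for p
    unfolding site_def assms[symmetric] map_pmf_rep_eq by (rule distr_cong) simp_all
  then show "distr (PiM (V \<times> UNIV) (\<lambda>p. measure_pmf (q p))) (law \<theta> V) (\<lambda>k. \<lambda>p\<in>V \<times> UNIV. h (k p)) = law \<theta> V"
    unfolding law_def
    by (subst distr_PiM_map) (auto simp: measurable_site intro: measure_pmf.prob_space_axioms)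
  show "(\<lambda>k. \<lambda>p\<in>V \<times> UNIV. h (k p)) \<in> measurable (PiM (V \<times> UNIV) (\<lambda>p. measure_pmf (q p))) (law \<theta> V)"
    unfolding law_def
  proof (rule measurable_restrict)
    fix p :: "nat list \<times> nat" assume p: "p \<in> V \<times> UNIV"
    show "(\<lambda>k. h (k p)) \<in> measurable (PiM (V \<times> UNIV) (\<lambda>p. measure_pmf (q p))) (site \<theta> p)"
      unfolding measurable_site
      by (rule measurable_compose[OF measurable_component_singleton[OF p]]) simp
  qed
qed

lemma consensus_mono:
  assumes \<theta>: "-1 \<le> \<theta>" "\<theta> \<le> \<theta>'" "\<theta>' \<le> 1" and cons: "AE f in law \<theta> V. consensus V f"
  shows "AE f in law \<theta>' V. consensus V f"
proof -
  obtain q0 where q0: "map_pmf fst q0 = spin_pmf \<theta>" "map_pmf snd q0 = spin_pmf \<theta>'"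
    "\<And>a b. (a, b) \<in> set_pmf q0 \<Longrightarrow> a \<le> b" using spin_coupling[OF \<theta>] by blast
  \<comment> \<open>Initial spins are coupled in increasing order, while the tie-breaking spins are
    shared by both copies.\<close>
  define q :: "nat list \<times> nat \<Rightarrow> (int \<times> int) pmf"
    where "q p = (if snd p = 0 then q0 else map_pmf (\<lambda>c. (c, c)) coin_pmf)" for p
  let ?K = "PiM (V \<times> UNIV) (\<lambda>p. measure_pmf (q p))"
  let ?F = "\<lambda>k. \<lambda>p\<in>V \<times> UNIV. fst (k p)" and ?S = "\<lambda>k. \<lambda>p\<in>V \<times> UNIV. snd (k p)"
  have q1: "map_pmf fst (q p) = (if snd p = 0 then spin_pmf \<theta> else coin_pmf)"
    and q2: "map_pmf snd (q p) = (if snd p = 0 then spin_pmf \<theta>' else coin_pmf)" for p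
    using q0 by (auto simp: q_def pmf.map_comp comp_def)
  note F = distr_law_map[of fst q, OF q1] and S = distr_law_map[of snd q, OF q2]
  have le: "AE k in ?K. \<forall>p\<in>V \<times> UNIV. fst (k p) \<le> snd (k p)"
  proof (rule AE_ball_countable[THEN iffD2, OF _ ballI])
    fix p :: "nat list \<times> nat" assume p: "p \<in> V \<times> UNIV"
    show "AE k in ?K. fst (k p) \<le> snd (k p)"
      using q0(3) by (intro AE_PiM_component measure_pmf.prob_space_axioms p)
        (auto simp: AE_measure_pmf_iff q_def)
  qed simp
  have "AE f in distr ?K (law \<theta> V) ?F. consensus V f \<and> (\<forall>p\<in>V \<times> UNIV. f p \<in> {-1, 1})"
    unfolding F(1) using cons AE_law_values by (rule AE_conjI)
  then have 1: "AE k in ?K. consensus V (?F k) \<and> (\<forall>p\<in>V \<times> UNIV. ?F k p \<in> {-1, 1})"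
    by (rule AE_distrD[OF F(2)])
  have "AE f in distr ?K (law \<theta>' V) ?S. \<forall>p\<in>V \<times> UNIV. f p \<in> {-1, 1}"
    unfolding S(1) by (rule AE_law_values)
  then have 2: "AE k in ?K. \<forall>p\<in>V \<times> UNIV. ?S k p \<in> {-1, 1}"
    by (rule AE_distrD[OF S(2)])
  have "AE k in ?K. consensus V (?S k)"
    using 1 2 le
  proof eventually_elim
    case (elim k)
    have "dyn V (\<lambda>_. 0) (?S k) t i = 1" if "dyn V (\<lambda>_. 0) (?F k) t i = 1" "i \<in> V" for t i
      using dyn_mono[of V "?F k" "?S k" i "\<lambda>_. 0" t] dyn_values[of V "?S k" i "\<lambda>_. 0" t] elim that by auto
    then show ?case using elim unfolding consensus_def int_tendsto_iff by blast
  qed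
  then have "AE f in distr ?K (law \<theta>' V) ?S. consensus V f"
    using AE_distr_iff[OF S(2) measurable_consensus[of \<theta>' V]] by simp
  then show ?thesis unfolding S(1) .
qed

text \<open>Negating all coordinates preserves the law at parameter 0 and negates every spin, so
  consensus on \<open>1\<close> would hold almost surely for \<open>f\<close> and for
  \<open>- f\<close> together.\<close>

lemma no_consensus_0:
  assumes "V \<noteq> {}"
  shows "\<not> (AE f in law 0 V. consensus V f)"
proof
  assume cons: "AE f in law 0 V. consensus V f"
  interpret prob_space "law 0 V" by (rule prob_space_law)
  have sym: "map_pmf uminus (spin_pmf 0) = spin_pmf 0"
  proof -
    have "map_pmf uminus (spin_pmf 0) = map_pmf (\<lambda>b. if b then 1 else - 1) (map_pmf Not (bernoulli_pmf (1 / 2)))"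
      unfolding spin_pmf_def pmf.map_comp by (intro pmf.map_cong) (auto simp: comp_def)
    also have "map_pmf Not (bernoulli_pmf (1 / 2)) = bernoulli_pmf (1 / 2)"
      unfolding bernoulli_pmf_half_conv_pmf_of_set by (subst map_pmf_of_set_inj) (auto simp: inj_on_def UNIV_bool insert_commute)
    finally show ?thesis by (simp add: spin_pmf_def)
  qed
  define q :: "nat list \<times> nat \<Rightarrow> int pmf" where "q p = (if snd p = 0 then spin_pmf 0 else coin_pmf)" for p
  have "map_pmf uminus (q p) = (if snd p = 0 then spin_pmf 0 else coin_pmf)" for p
    using sym by (simp add: coin_minus q_def)
  note D = distr_law_map[of uminus q 0, OF this, of V]
  have K: "PiM (V \<times> UNIV) (\<lambda>p. measure_pmf (q p)) = law 0 V"
    unfolding law_def site_def q_def ..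
  note D = D[unfolded K]
  have "AE f in distr (law 0 V) (law 0 V) (\<lambda>f. \<lambda>p\<in>V \<times> UNIV. - f p). consensus V f"
    unfolding D(1) by (rule cons)
  then have "AE f in law 0 V. consensus V (\<lambda>p\<in>V \<times> UNIV. - f p)"
    by (rule AE_distrD[OF D(2)])
  with cons have "AE f in law 0 V. False"
  proof eventually_elim
    case (elim f)
    obtain v where v: "v \<in> V" using assms by auto
    have "(\<lambda>t. dyn V (\<lambda>_. 0) f t v) \<longlonglongrightarrow> 1" "(\<lambda>t. - dyn V (\<lambda>_. 0) f t v) \<longlonglongrightarrow> 1"
      using elim v dyn_uminus[of V "\<lambda>p\<in>V \<times> UNIV. - f p" f v] by (auto simp: consensus_def)
    then obtain N N' where "\<forall>n\<ge>N. dyn V (\<lambda>_. 0) f n v = 1" "\<forall>n\<ge>N'. - dyn V (\<lambda>_. 0) f n v = 1"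
      unfolding int_tendsto_iff by blast
    from spec[OF this(1), of "max N N'"] spec[OF this(2), of "max N N'"] show ?case by simp
  qed
  then show False using AE_False by simp
qed

section \<open>Decomposition at the root\<close>

text \<open>The coordinates are independent because their joint law is the product itself; grouping
  them into disjoint blocks keeps independence, and the law of each block is the product over that
  block.\<close>

lemma measure_PiM_blocks:
  assumes M: "\<And>i. i \<in> I \<Longrightarrow> prob_space (M i)"
    and L: "finite L" "L \<noteq> {}"
    and K: "\<And>j. j \<in> L \<Longrightarrow> K j \<subseteq> I" "disjoint_family_on K L"
    and A: "\<And>j. j \<in> L \<Longrightarrow> A j \<in> sets (PiM (K j) M)"
  shows "\<P>(f in PiM I M. \<forall>j\<in>L. restrict f (K j) \<in> A j) = (\<Prod>j\<in>L. measure (PiM (K j) M) (A j))"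
proof -
  interpret P: prob_space "PiM I M" by (rule prob_space_PiM[OF M])
  have "P.indep_vars M (\<lambda>i f. f i) I"
  proof (cases "I = {}")
    case True
    show ?thesis unfolding P.indep_vars_def P.indep_sets_def using True by auto
  next
    case False
    have "distr (PiM I M) (PiM I M) (\<lambda>f. \<lambda>i\<in>I. f i) = PiM I (\<lambda>i. distr (PiM I M) (M i) (\<lambda>f. f i))"
    proof -
      have "distr (PiM I M) (PiM I M) (\<lambda>f. \<lambda>i\<in>I. f i) = distr (PiM I M) (PiM I M) (\<lambda>f. f)"
        by (rule distr_cong) (auto simp: space_PiM restrict_def PiE_iff extensional_def fun_eq_iff)
      also have "\<dots> = PiM I M" by (rule distr_id)
      also have "\<dots> = PiM I (\<lambda>i. distr (PiM I M) (M i) (\<lambda>f. f i))"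
        by (intro PiM_cong refl distr_PiM_component[symmetric] M)
      finally show ?thesis .
    qed
    then show ?thesis
      by (subst P.indep_vars_iff_distr_eq_PiM'[OF False]) simp_all
  qed
  from P.indep_vars_restrict[OF this K]
  have "P.indep_vars (\<lambda>j. PiM (K j) M) (\<lambda>j f. restrict f (K j)) L" .
  from P.indep_varsD_finite[OF this L(2,1) A]
  have "P.prob (\<Inter>j\<in>L. (\<lambda>f. restrict f (K j)) -` A j \<inter> space (PiM I M))
      = (\<Prod>j\<in>L. P.prob ((\<lambda>f. restrict f (K j)) -` A j \<inter> space (PiM I M)))" .
  also have "(\<Inter>j\<in>L. (\<lambda>f. restrict f (K j)) -` A j \<inter> space (PiM I M))
      = {f \<in> space (PiM I M). \<forall>j\<in>L. restrict f (K j) \<in> A j}"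
    using L(2) by auto
  also have "(\<Prod>j\<in>L. P.prob ((\<lambda>f. restrict f (K j)) -` A j \<inter> space (PiM I M)))
      = (\<Prod>j\<in>L. measure (PiM (K j) M) (A j))"
  proof (rule prod.cong[OF refl])
    fix j assume j: "j \<in> L"
    have "distr (PiM I M) (PiM (K j) M) (\<lambda>f. \<lambda>i\<in>K j. f i) = PiM (K j) M"
      using M K(1)[OF j] by (intro distr_PiM_reindex) auto
    moreover have "(\<lambda>f. restrict f (K j)) \<in> measurable (PiM I M) (PiM (K j) M)"
      by (rule measurable_restrict_subset[OF K(1)[OF j]])
    ultimately show "P.prob ((\<lambda>f. restrict f (K j)) -` A j \<inter> space (PiM I M)) = measure (PiM (K j) M) (A j)"
      using measure_distr[OF _ A[OF j], of "\<lambda>f. restrict f (K j)" "PiM I M"] by simp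
  qed
  finally show ?thesis .
qed

text \<open>A root with \<open>n\<close> children covers both trees, so that a single decomposition
  at the root serves the recursion and the final estimate.\<close>

definition tree :: "nat \<Rightarrow> nat \<Rightarrow> nat list set" where
  "tree k n = {v. set (butlast v) \<subseteq> {1..k - 1} \<and> (v \<noteq> [] \<longrightarrow> last v \<in> {1..n})}"

lemma regular_tree_eq: "regular_tree k = tree k k"
  by (simp add: regular_tree_def tree_def)

lemma tree_Nil[simp]: "[] \<in> tree k n"
  by (simp add: tree_def)

lemma rooted_Nil[simp]: "[] \<in> rooted_tree k"
  by (simp add: rooted_tree_def)

lemma tree_snoc: "w @ [x] \<in> tree k n \<longleftrightarrow> w \<in> rooted_tree k \<and> x \<in> {1..n}"
  by (auto simp: tree_def rooted_tree_def)

lemma rooted_tree_eq: "rooted_tree k = tree k (k - 1)"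
proof (rule set_eqI)
  fix v show "v \<in> rooted_tree k \<longleftrightarrow> v \<in> tree k (k - 1)"
    by (cases v rule: rev_cases) (auto simp: tree_snoc rooted_tree_def)
qed

lemma rooted_Cons: "x # w \<in> rooted_tree k \<longleftrightarrow> x \<in> {1..k - 1} \<and> w \<in> rooted_tree k"
  by (auto simp: rooted_tree_def)

lemma tree_single[simp]: "[x] \<in> tree k n \<longleftrightarrow> x \<in> {1..n}"
  using tree_snoc[of "[]" x k n] by simp

lemma nbrs_tree_root: "nbrs (tree k n) [] = (\<lambda>x. [x]) ` {1..n}"
  by (auto simp: nbrs_def)

text \<open>Labels are read upwards, so appending \<open>x\<close> at the end moves a vertex of the
  rooted tree into the branch at child \<open>x\<close>. The top of the branch is the one vertex
  that gains a neighbour, namely the root.\<close>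

lemma nbrs_tree_snoc:
  assumes "w \<in> rooted_tree k" "x \<in> {1..n}"
  shows "nbrs (tree k n) (w @ [x]) = (if w = [] then {[]} else {}) \<union> (\<lambda>v. v @ [x]) ` nbrs (rooted_tree k) w"
proof (intro equalityI subsetI)
  fix j assume j: "j \<in> nbrs (tree k n) (w @ [x])"
  then consider y where "j = (y # w) @ [x]" | y where "w @ [x] = y # j" by (auto simp: nbrs_def)
  then show "j \<in> (if w = [] then {[]} else {}) \<union> (\<lambda>v. v @ [x]) ` nbrs (rooted_tree k) w"
  proof cases
    case 1
    then have "y # w \<in> rooted_tree k" using j by (auto simp: nbrs_def simp flip: append_Cons simp add: tree_snoc)
    then show ?thesis using 1 by (auto simp: nbrs_def)
  next
    case 2
    then show ?thesis using assms
      by (cases w) (auto simp: nbrs_def rooted_Cons)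
  qed
next
  fix j assume "j \<in> (if w = [] then {[]} else {}) \<union> (\<lambda>v. v @ [x]) ` nbrs (rooted_tree k) w"
  then show "j \<in> nbrs (tree k n) (w @ [x])"
    using assms tree_snoc[of "_ # w" x k n] by (auto simp: nbrs_def tree_snoc split: if_splits)
qed

lemma finite_nbrs_rooted: "finite (nbrs (rooted_tree k) w)"
proof (rule finite_subset)
  show "nbrs (rooted_tree k) w \<subseteq> (\<lambda>x. x # w) ` {1..k - 1} \<union> {tl w}"
    by (auto simp: nbrs_def rooted_Cons)
qed simp

lemma sum_nbrs_tree_snoc:
  fixes F :: "nat list \<Rightarrow> int"
  assumes "w \<in> rooted_tree k" "x \<in> {1..n}"
  shows "(\<Sum>j\<in>nbrs (tree k n) (w @ [x]). F j)
    = (\<Sum>v\<in>nbrs (rooted_tree k) w. F (v @ [x])) + (if w = [] then F [] else 0)"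
proof -
  have "(\<Sum>j\<in>(\<lambda>v. v @ [x]) ` nbrs (rooted_tree k) w. F j) = (\<Sum>v\<in>nbrs (rooted_tree k) w. F (v @ [x]))"
    by (subst sum.reindex) (auto simp: inj_on_def)
  then show ?thesis
    unfolding nbrs_tree_snoc[OF assms]
    by (subst sum.union_disjoint) (auto simp: finite_nbrs_rooted)
qed

lemma sum_nbrs_tree_root:
  fixes F :: "nat list \<Rightarrow> int"
  shows "(\<Sum>j\<in>nbrs (tree k n) []. F j) = (\<Sum>x=1..n. F [x])"
  unfolding nbrs_tree_root by (subst sum.reindex) (auto simp: inj_on_def)

section \<open>Branches at the root as dynamics in a prescribed field\<close>

definition branch :: "nat \<Rightarrow> nat \<Rightarrow> (nat list \<times> nat \<Rightarrow> int) \<Rightarrow> nat list \<times> nat \<Rightarrow> int" where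
  "branch k x f = (\<lambda>p\<in>rooted_tree k \<times> UNIV. f (fst p @ [x], snd p))"

text \<open>The outside reaches the branch through the root alone, whose spin enters the sum at
  \<open>[x]\<close> exactly as a field does. The spins at time \<open>t\<close> read the field
  strictly before \<open>t\<close>.\<close>

lemma dyn_branch:
  assumes x: "x \<in> {1..n}"
  shows "\<forall>s<t. dyn (tree k n) u f s [] = \<sigma> s \<Longrightarrow> w \<in> rooted_tree k \<Longrightarrow>
    dyn (tree k n) u f t (w @ [x]) = dyn (rooted_tree k) \<sigma> (branch k x f) t w"
proof (induction t arbitrary: w)
  case 0
  then show ?case by (simp add: branch_def)
next
  case (Suc t)
  have "(\<Sum>v\<in>nbrs (rooted_tree k) w. dyn (tree k n) u f t (v @ [x]))
      = (\<Sum>v\<in>nbrs (rooted_tree k) w. dyn (rooted_tree k) \<sigma> (branch k x f) t v)"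
    using Suc.prems(1) nbrs_subset by (intro sum.cong refl Suc.IH) (auto dest: subsetD[OF nbrs_subset])
  moreover have "dyn (tree k n) u f t [] = \<sigma> t" using Suc.prems(1) by simp
  moreover have "branch k x f (w, Suc t) = f (w @ [x], Suc t)"
    using Suc.prems(2) by (simp add: branch_def)
  ultimately show ?case
    using sum_nbrs_tree_snoc[OF Suc.prems(2) x, of "dyn (tree k n) u f t"] by (simp add: Let_def)
qed

text \<open>The part of the event that concerns the coordinates of the root: without a tie it
  restricts \<open>\<sigma>\<close> and \<open>s\<close> only, in a tie it prescribes one
  coordinate.\<close>

definition root_ok :: "nat \<Rightarrow> nat \<Rightarrow> (nat \<Rightarrow> int) \<Rightarrow> (nat \<Rightarrow> int) \<Rightarrow> (nat \<Rightarrow> nat \<Rightarrow> int) \<Rightarrow> (nat list \<times> nat \<Rightarrow> int) \<Rightarrow> bool" where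
  "root_ok n T u \<sigma> s f \<longleftrightarrow> f ([], 0) = \<sigma> 0 \<and>
     (\<forall>t<T. let z = (\<Sum>x=1..n. s x t) + u t in
        if z \<noteq> 0 then \<sigma> (Suc t) = sgn z else f ([], Suc t) = \<sigma> (Suc t))"

text \<open>Root and children depend on each other, but always with a delay of one step, so
  induction on time unties the loop. On the right each branch runs in the prescribed field
  \<open>\<sigma>\<close>, and no condition refers to the coordinates of another block.\<close>

lemma dyn_tree_iff:
  "(\<forall>t\<le>T. dyn (tree k n) u f t [] = \<sigma> t) \<and> (\<forall>x\<in>{1..n}. \<forall>t\<le>T. dyn (tree k n) u f t [x] = s x t)
    \<longleftrightarrow> root_ok n T u \<sigma> s f \<and> (\<forall>x\<in>{1..n}. \<forall>t\<le>T. dyn (rooted_tree k) \<sigma> (branch k x f) t [] = s x t)"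
  (is "?R \<and> ?C \<longleftrightarrow> ?O \<and> ?B")
proof -
  have B: "dyn (tree k n) u f t [x] = dyn (rooted_tree k) \<sigma> (branch k x f) t []"
    if "\<forall>s<t. dyn (tree k n) u f s [] = \<sigma> s" "x \<in> {1..n}" for x t
    using dyn_branch[OF that(2,1), of "[]"] by simp
  have step: "dyn (tree k n) u f (Suc t) [] =
      (let z = (\<Sum>x=1..n. dyn (tree k n) u f t [x]) + u t in if z \<noteq> 0 then sgn z else f ([], Suc t))" for t
    using sum_nbrs_tree_root[of "dyn (tree k n) u f t" k n] by simp
  show ?thesis
  proof
    assume RC: "?R \<and> ?C"
    have ?O unfolding root_ok_def
    proof (intro conjI allI impI)
      show "f ([], 0) = \<sigma> 0" using RC by (metis dyn.simps(1) le0)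
      fix t assume t: "t < T"
      have "(\<Sum>x=1..n. s x t) = (\<Sum>x=1..n. dyn (tree k n) u f t [x])"
        using RC t by (intro sum.cong) auto
      moreover have "dyn (tree k n) u f (Suc t) [] = \<sigma> (Suc t)" using RC Suc_leI[OF t] by blast
      ultimately show "let z = (\<Sum>x=1..n. s x t) + u t in
        if z \<noteq> 0 then \<sigma> (Suc t) = sgn z else f ([], Suc t) = \<sigma> (Suc t)"
        unfolding step by (simp add: Let_def split: if_splits)
    qed
    moreover have ?B using RC B by (metis le_trans less_imp_le_nat)
    ultimately show "?O \<and> ?B" by blast
  next
    assume OB: "?O \<and> ?B"
    have root: "t \<le> T \<Longrightarrow> \<forall>r\<le>t. dyn (tree k n) u f r [] = \<sigma> r" for t
    proof (induction t)
      case 0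
      then show ?case using OB by (simp add: root_ok_def)
    next
      case (Suc t)
      then have IH: "\<forall>r\<le>t. dyn (tree k n) u f r [] = \<sigma> r" by simp
      have "(\<Sum>x=1..n. dyn (tree k n) u f t [x]) = (\<Sum>x=1..n. s x t)"
      proof (rule sum.cong[OF refl])
        fix x assume x: "x \<in> {1..n}"
        then show "dyn (tree k n) u f t [x] = s x t" using OB IH B[OF _ x, of t] Suc.prems by simp
      qed
      then have "dyn (tree k n) u f (Suc t) [] = \<sigma> (Suc t)"
        using OB Suc.prems unfolding step root_ok_def by (auto simp: Let_def split: if_splits)
      then show ?case using IH by (simp add: le_Suc_eq)
    qed
    have ?R using root[of T] by simp
    moreover have ?C using OB root B by (metis less_imp_le_nat)
    ultimately show "?R \<and> ?C" by blast
  qed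
qed

text \<open>
  The alternating structure of depth \<open>d\<close> below \<open>v\<close>, where \<open>b\<close> means that \<open>v\<close> is in the odd class,
  on which \<open>\<eta>\<close> is unconstrained. The number of children required is
  \<open>k div 2 = \<lceil>(k + 1) / 2\<rceil> - 1\<close>.
\<close>

primrec alt_core :: "nat \<Rightarrow> bool \<Rightarrow> nat \<Rightarrow> (nat list \<Rightarrow> int) \<Rightarrow> nat list \<Rightarrow> bool" where
  "alt_core k b 0 \<eta> v \<longleftrightarrow> b \<or> \<eta> v = - 1"
| "alt_core k b (Suc d) \<eta> v \<longleftrightarrow> (b \<or> \<eta> v = - 1) \<and> k div 2 \<le> card {x \<in> {1..k - 1}. alt_core k (\<not> b) d \<eta> (x # v)}"


lemma alt_core_append: "alt_core k b d \<eta> (w @ v) = alt_core k b d (\<lambda>w. \<eta> (w @ v)) w"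
proof (induction d arbitrary: b w)
  case (Suc d)
  show ?case using Suc.IH[of "\<not> b" "_ # w"] by simp
qed simp

lemma alt_core_cong:
  "(\<And>w. w \<in> rooted_tree k \<Longrightarrow> \<eta> w = \<eta>' w) \<Longrightarrow> w \<in> rooted_tree k \<Longrightarrow> alt_core k b d \<eta> w = alt_core k b d \<eta>' w"
proof (induction d arbitrary: b w)
  case (Suc d)
  have "{x \<in> {1..k - 1}. alt_core k (\<not> b) d \<eta> (x # w)} = {x \<in> {1..k - 1}. alt_core k (\<not> b) d \<eta>' (x # w)}"
    using Suc.IH[OF Suc.prems(1)] Suc.prems(2) by (auto simp: rooted_Cons)
  then show ?case using Suc.prems by simp
qed simp

lemma alt_core_branch:
  assumes "\<forall>t<T. dyn (tree k n) u f t [] = \<sigma> t" and x: "x \<in> {1..n}"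
  shows "alt_core k b d (dyn (tree k n) u f T) [x] = alt_core k b d (dyn (rooted_tree k) \<sigma> (branch k x f) T) []"
proof -
  have "alt_core k b d (dyn (tree k n) u f T) ([] @ [x]) = alt_core k b d (\<lambda>w. dyn (tree k n) u f T (w @ [x])) []"
    by (rule alt_core_append)
  also have "\<dots> = alt_core k b d (dyn (rooted_tree k) \<sigma> (branch k x f) T) []"
    using dyn_branch[OF x assms(1)] by (intro alt_core_cong) auto
  finally show ?thesis by simp
qed

lemma alt_core_Suc_imp: "alt_core k b (Suc d) \<eta> v \<Longrightarrow> alt_core k b d \<eta> v"
proof (induction d arbitrary: b v)
  case (Suc d)
  have "{x \<in> {1..k - 1}. alt_core k (\<not> b) (Suc d) \<eta> (x # v)} \<subseteq> {x \<in> {1..k - 1}. alt_core k (\<not> b) d \<eta> (x # v)}"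
    using Suc.IH by blast
  then have "card {x \<in> {1..k - 1}. alt_core k (\<not> b) (Suc d) \<eta> (x # v)} \<le> card {x \<in> {1..k - 1}. alt_core k (\<not> b) d \<eta> (x # v)}"
    by (intro card_mono) auto
  moreover from Suc.prems have "(b \<or> \<eta> v = - 1) \<and> k div 2 \<le> card {x \<in> {1..k - 1}. alt_core k (\<not> b) (Suc d) \<eta> (x # v)}"
    by (simp only: alt_core.simps)
  ultimately show ?case by simp
qed simp

text \<open>\<open>D\<close> is the whole rooted tree or, inside \<open>tree k n\<close> with
  arbitrary \<open>n\<close>, the branch below one child.\<close>

lemma alt_core_measurable:
  assumes "D \<subseteq> V" and closed: "\<And>v x. v \<in> D \<Longrightarrow> x \<in> {1..k - 1} \<Longrightarrow> x # v \<in> D"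
  shows "v \<in> D \<Longrightarrow> {f \<in> space (law \<theta> V). alt_core k b d (dyn V u f T) v} \<in> sets (law \<theta> V)"
proof (induction d arbitrary: b v)
  case 0
  then have "v \<in> V" using assms by auto
  from sets_Collect_discrete[OF measurable_dyn[OF this], of \<theta> "\<lambda>a. b \<or> a = - 1" u T]
  show ?case unfolding alt_core.simps .
next
  case (Suc d)
  then have v: "v \<in> V" using assms by auto
  have 1: "{f \<in> space (law \<theta> V). b \<or> dyn V u f T v = - 1} \<in> sets (law \<theta> V)"
    by (rule sets_Collect_discrete[OF measurable_dyn[OF v], of \<theta> "\<lambda>a. b \<or> a = - 1" u T])
  have 2: "{f \<in> space (law \<theta> V). \<exists>X\<in>{X. X \<subseteq> {1..k - 1} \<and> k div 2 \<le> card X}. \<forall>x\<in>X. alt_core k (\<not> b) d (dyn V u f T) (x # v)} \<in> sets (law \<theta> V)"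
  proof (rule sets.sets_Collect_finite_Ex, rule sets.sets_Collect_finite_All)
    fix X x assume "X \<in> {X. X \<subseteq> {1..k - 1} \<and> k div 2 \<le> card X}" "x \<in> X"
    then have "x \<in> {1..k - 1}" by auto
    then show "{f \<in> space (law \<theta> V). alt_core k (\<not> b) d (dyn V u f T) (x # v)} \<in> sets (law \<theta> V)"
      by (intro Suc.IH closed Suc.prems)
  next
    fix X assume "X \<in> {X. X \<subseteq> {1..k - 1} \<and> k div 2 \<le> card X}"
    then show "finite X" by (auto intro: finite_subset)
  next
    have "finite (Pow {1..k - 1})" by simp
    then show "finite {X. X \<subseteq> {1..k - 1} \<and> k div 2 \<le> card X}"
      by (rule rev_finite_subset) auto
  qed
  \<comment> \<open>The count is expressed by finitely many possible witness sets, which reduces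
    measurability to finite unions and intersections.\<close>
  have eq: "(k div 2 \<le> card {x \<in> {1..k - 1}. Q x}) = (\<exists>X\<in>{X. X \<subseteq> {1..k - 1} \<and> k div 2 \<le> card X}. \<forall>x\<in>X. Q x)" for Q
  proof
    assume "\<exists>X\<in>{X. X \<subseteq> {1..k - 1} \<and> k div 2 \<le> card X}. \<forall>x\<in>X. Q x"
    then obtain X where X: "X \<subseteq> {1..k - 1}" "k div 2 \<le> card X" "\<forall>x\<in>X. Q x" by blast
    then have "card X \<le> card {x \<in> {1..k - 1}. Q x}" by (intro card_mono) auto
    with X show "k div 2 \<le> card {x \<in> {1..k - 1}. Q x}" by simp
  qed (intro bexI[of _ "{x \<in> {1..k - 1}. Q x}"], auto)
  have "{f \<in> space (law \<theta> V). alt_core k b (Suc d) (dyn V u f T) v}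
      = {f \<in> space (law \<theta> V). b \<or> dyn V u f T v = - 1}
        \<inter> {f \<in> space (law \<theta> V). \<exists>X\<in>{X. X \<subseteq> {1..k - 1} \<and> k div 2 \<le> card X}. \<forall>x\<in>X. alt_core k (\<not> b) d (dyn V u f T) (x # v)}"
    unfolding alt_core.simps eq by blast
  then show ?case using sets.Int[OF 1 2] by (simp only:)
qed

section \<open>Factorization of probabilities over the root and its branches\<close>

lemma measure_tree_blocks:
  assumes R: "R \<in> sets (PiM ({[]} \<times> UNIV) (site \<theta>))"
    and Q: "\<And>x. x \<in> {1..n} \<Longrightarrow> Q x \<in> sets (law \<theta> (rooted_tree k))"
  shows "\<P>(f in law \<theta> (tree k n). restrict f ({[]} \<times> UNIV) \<in> R \<and> (\<forall>x\<in>{1..n}. branch k x f \<in> Q x))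
    = measure (PiM ({[]} \<times> UNIV) (site \<theta>)) R * (\<Prod>x\<in>{1..n}. measure (law \<theta> (rooted_tree k)) (Q x))"
proof -
  \<comment> \<open>Block 0 belongs to the root and block \<open>x\<close> to the branch at child
    \<open>x\<close>; the index 0 is free because labels start at 1.\<close>
  define K where "K x = (if x = 0 then {[]} else (\<lambda>w. w @ [x]) ` rooted_tree k) \<times> (UNIV :: nat set)" for x :: nat
  define s where "s x h = (\<lambda>p\<in>rooted_tree k \<times> UNIV. h (fst p @ [x], snd p))" for x and h :: "nat list \<times> nat \<Rightarrow> int"
  define A where "A x = (if x = 0 then R else s x -` Q x \<inter> space (PiM (K x) (site \<theta>)))" for x
  have K0: "K 0 = {[]} \<times> UNIV" by (simp add: K_def)
  have sK: "(fst p @ [x], snd p) \<in> K x" if "p \<in> rooted_tree k \<times> UNIV" "x \<in> {1..n}" for p x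
    using that by (auto simp: K_def)
  \<comment> \<open>The law of a coordinate depends on its level but not on its vertex, so renaming
    vertices is harmless.\<close>
  have law_eq: "law \<theta> (rooted_tree k) = PiM (rooted_tree k \<times> UNIV) (\<lambda>p. site \<theta> (fst p @ [x], snd p))" for x
    unfolding law_def by (intro PiM_cong) (auto simp: site_def)
  have sm: "s x \<in> measurable (PiM (K x) (site \<theta>)) (law \<theta> (rooted_tree k))" if "x \<in> {1..n}" for x
    unfolding s_def law_def
  proof (rule measurable_restrict)
    fix p :: "nat list \<times> nat" assume p: "p \<in> rooted_tree k \<times> UNIV"
    show "(\<lambda>f. f (fst p @ [x], snd p)) \<in> measurable (PiM (K x) (site \<theta>)) (site \<theta> p)"
      using measurable_component_singleton[OF sK[OF p that], of "site \<theta>"] by (simp add: measurable_site)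
  qed
  have ds: "distr (PiM (K x) (site \<theta>)) (law \<theta> (rooted_tree k)) (s x) = law \<theta> (rooted_tree k)" if "x \<in> {1..n}" for x
    unfolding law_eq[of x] s_def
    using sK[OF _ that] by (intro distr_PiM_reindex prob_space_site) (auto simp: inj_on_def)
  have A: "A x \<in> sets (PiM (K x) (site \<theta>))" if "x \<in> {0..n}" for x
    using R Q measurable_sets[OF sm] that by (cases "x = 0") (auto simp: A_def K0)
  have mA: "measure (PiM (K x) (site \<theta>)) (A x) = measure (law \<theta> (rooted_tree k)) (Q x)" if "x \<in> {1..n}" for x
    using measure_distr[OF sm[OF that] Q[OF that]] ds[OF that] that by (simp add: A_def)
  have iff: "(\<forall>x\<in>insert 0 {1..n}. restrict f (K x) \<in> A x)
      \<longleftrightarrow> restrict f ({[]} \<times> UNIV) \<in> R \<and> (\<forall>x\<in>{1..n}. branch k x f \<in> Q x)" for f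
  proof -
    have "restrict f (K x) \<in> space (PiM (K x) (site \<theta>))" for x
      by (auto simp: space_PiM)
    moreover have "s x (restrict f (K x)) = branch k x f" if "x \<in> {1..n}" for x
      unfolding s_def branch_def using sK[OF _ that] by (intro restrict_ext) auto
    ultimately show ?thesis by (auto simp: A_def K0)
  qed
  have "\<P>(f in PiM (tree k n \<times> UNIV) (site \<theta>). \<forall>x\<in>{0..n}. restrict f (K x) \<in> A x)
      = (\<Prod>x\<in>{0..n}. measure (PiM (K x) (site \<theta>)) (A x))"
  proof (rule measure_PiM_blocks[OF prob_space_site])
    show "K x \<subseteq> tree k n \<times> UNIV" if "x \<in> {0..n}" for x
      using that by (auto simp: K_def tree_snoc split: if_splits)
    show "disjoint_family_on K {0..n}"
      by (auto simp: disjoint_family_on_def K_def split: if_splits)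
  qed (use A in auto)
  also have "{0..n} = insert 0 {1..n}" by auto
  also have "(\<Prod>x\<in>insert 0 {1..n}. measure (PiM (K x) (site \<theta>)) (A x))
      = measure (PiM ({[]} \<times> UNIV) (site \<theta>)) R * (\<Prod>x\<in>{1..n}. measure (law \<theta> (rooted_tree k)) (Q x))"
    using mA by (simp add: A_def K0)
  finally show ?thesis using iff by (simp only: law_def[of \<theta> "tree k n"])
qed

text \<open>Each time step constrains one coordinate of the root: without a tie by everything or
  nothing, giving an indicator, in a tie by a single value of a fair coin, giving 1/2. The argument
  \<open>Suc n\<close> appears because \<open>kernel k\<close> sums over \<open>k - 1\<close>
  children.\<close>

lemma measure_root_block:
  fixes \<theta> :: real and n :: nat and u :: "nat \<Rightarrow> int" and s :: "nat \<Rightarrow> nat \<Rightarrow> int"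
  assumes \<sigma>: "\<sigma> \<in> trajs T"
  defines "R \<equiv> {f \<in> space (PiM ({[]} \<times> UNIV) (site \<theta>)). root_ok n T u \<sigma> s f}"
  shows "R \<in> sets (PiM ({[]} \<times> UNIV) (site \<theta>))"
    and "measure (PiM ({[]} \<times> UNIV) (site \<theta>)) R
      = pmf (spin_pmf \<theta>) (\<sigma> 0) * (\<Prod>t<T. kernel (Suc n) (u t) (\<sigma> (t + 1)) (\<lambda>x. s x t))"
proof -
  let ?I = "{[]} \<times> (UNIV :: nat set)" and ?z = "\<lambda>t. (\<Sum>x=1..n. s x t) + u t"
  define F :: "nat list \<times> nat \<Rightarrow> int set" where
    "F p = (case snd p of 0 \<Rightarrow> {\<sigma> 0}
      | Suc t \<Rightarrow> if ?z t \<noteq> 0 then (if \<sigma> (Suc t) = sgn (?z t) then UNIV else {}) else {\<sigma> (Suc t)})" for p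
  let ?J = "Pair [] ` {..T} :: (nat list \<times> nat) set"
  have F: "F p \<in> sets (site \<theta> p)" for p by (simp add: sets_site)
  have "root_ok n T u \<sigma> s f \<longleftrightarrow> (\<forall>t\<le>T. f ([], t) \<in> F ([], t))" for f
  proof -
    have split: "(\<forall>t\<le>T. P t) \<longleftrightarrow> P 0 \<and> (\<forall>t<T. P (Suc t))" for P :: "nat \<Rightarrow> bool"
      using All_less_Suc2[of T P] by (simp only: less_Suc_eq_le)
    have "f ([], Suc t) \<in> F ([], Suc t) \<longleftrightarrow>
        (let z = ?z t in if z \<noteq> 0 then \<sigma> (Suc t) = sgn z else f ([], Suc t) = \<sigma> (Suc t))" for t
      by (simp only: F_def snd_conv nat.case Let_def if_distrib[of "\<lambda>A. _ \<in> A"] UNIV_I empty_iff singleton_iff if_bool_eq_conj) blast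
    moreover have "f ([], 0) \<in> F ([], 0) \<longleftrightarrow> f ([], 0) = \<sigma> 0" by (simp add: F_def)
    ultimately have "root_ok n T u \<sigma> s f \<longleftrightarrow> f ([], 0) \<in> F ([], 0) \<and> (\<forall>t<T. f ([], Suc t) \<in> F ([], Suc t))"
      by (simp only: root_ok_def)
    also have "\<dots> \<longleftrightarrow> (\<forall>t\<le>T. f ([], t) \<in> F ([], t))"
      by (rule split[symmetric])
    finally show ?thesis .
  qed
  then have R: "R = prod_emb ?I (site \<theta>) ?J (Pi\<^sub>E ?J F)"
    by (auto simp: R_def prod_emb_iff space_PiM PiE_iff)
  show "R \<in> sets (PiM ?I (site \<theta>))"
    unfolding R using F by (intro sets_PiM_I) auto
  interpret P: product_prob_space "site \<theta>" ?I
    by (intro product_prob_spaceI prob_space_site)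
  have "measure (PiM ?I (site \<theta>)) R = (\<Prod>p\<in>?J. measure (site \<theta> p) (F p))"
    unfolding R using F by (intro P.measure_PiM_emb) auto
  also have "\<dots> = (\<Prod>t\<le>T. measure (site \<theta> ([], t)) (F ([], t)))"
    by (subst prod.reindex) (auto simp: inj_on_def)
  also have "\<dots> = measure (site \<theta> ([], 0)) (F ([], 0)) * (\<Prod>t<T. measure (site \<theta> ([], Suc t)) (F ([], Suc t)))"
    by (rule prod.atMost_shift)
  also have "measure (site \<theta> ([], 0)) (F ([], 0)) = pmf (spin_pmf \<theta>) (\<sigma> 0)"
    by (simp add: site_def F_def measure_pmf_single)
  also have "(\<Prod>t<T. measure (site \<theta> ([], Suc t)) (F ([], Suc t)))
      = (\<Prod>t<T. kernel (Suc n) (u t) (\<sigma> (t + 1)) (\<lambda>x. s x t))"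
  proof (rule prod.cong[OF refl])
    fix t assume "t \<in> {..<T}"
    then have "\<sigma> (Suc t) \<in> {-1, 1}" using \<sigma> by (auto simp: trajs_def PiE_iff)
    then show "measure (site \<theta> ([], Suc t)) (F ([], Suc t)) = kernel (Suc n) (u t) (\<sigma> (t + 1)) (\<lambda>x. s x t)"
      by (auto simp: site_def F_def kernel_def Let_def measure_coin)
  qed
  finally show "measure (PiM ?I (site \<theta>)) R
      = pmf (spin_pmf \<theta>) (\<sigma> 0) * (\<Prod>t<T. kernel (Suc n) (u t) (\<sigma> (t + 1)) (\<lambda>x. s x t))" .
qed

lemma traj_measurable:
  assumes "v \<in> V"
  shows "{f \<in> space (law \<theta> V). \<forall>t\<le>T. dyn V u f t v = s t} \<in> sets (law \<theta> V)"
proof (rule sets.sets_Collect_countable_All)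
  fix t
  show "{f \<in> space (law \<theta> V). t \<le> T \<longrightarrow> dyn V u f t v = s t} \<in> sets (law \<theta> V)"
    by (rule sets_Collect_discrete[OF measurable_dyn[OF assms], of \<theta> "\<lambda>a. t \<le> T \<longrightarrow> a = s t"])
qed

lemma rooted_alt_core_measurable:
  "{f \<in> space (law \<theta> (rooted_tree k)). alt_core k b d (dyn (rooted_tree k) u f T) []} \<in> sets (law \<theta> (rooted_tree k))"
  by (rule alt_core_measurable[of "rooted_tree k"]) (auto simp: rooted_Cons)

lemma tree_alt_core_measurable:
  assumes "x \<in> {1..n}"
  shows "{f \<in> space (law \<theta> (tree k n)). alt_core k b d (dyn (tree k n) u f T) [x]} \<in> sets (law \<theta> (tree k n))"
proof (rule alt_core_measurable[of "(\<lambda>w. w @ [x]) ` rooted_tree k"])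
  show "(\<lambda>w. w @ [x]) ` rooted_tree k \<subseteq> tree k n" using assms by (auto simp: tree_snoc)
  show "[x] \<in> (\<lambda>w. w @ [x]) ` rooted_tree k" by (rule image_eqI[of _ _ "[]"]) simp_all
  fix v y assume "v \<in> (\<lambda>w. w @ [x]) ` rooted_tree k" "y \<in> {1..k - 1}"
  then obtain w where "v = w @ [x]" "w \<in> rooted_tree k" by blast
  then show "y # v \<in> (\<lambda>w. w @ [x]) ` rooted_tree k" using \<open>y \<in> {1..k - 1}\<close>
    by (intro image_eqI[of _ _ "y # w"]) (simp_all add: rooted_Cons)
qed

lemma sets_Collect_iff_const:
  assumes "{f \<in> space M. P f} \<in> sets M"
  shows "{f \<in> space M. P f \<longleftrightarrow> c} \<in> sets M"
proof (cases c)
  case True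
  then show ?thesis using assms by (simp only: simp_thms)
next
  case False
  then show ?thesis using sets.sets_Collect_neg[OF assms] by (simp only: simp_thms)
qed

lemma sets_Collect_and:
  "{f \<in> space M. P f} \<in> sets M \<Longrightarrow> {f \<in> space M. Q f} \<in> sets M \<Longrightarrow> {f \<in> space M. P f \<and> Q f} \<in> sets M"
  by (rule sets.sets_Collect_conj)

text \<open>The set \<open>X\<close> of children that carry the structure is prescribed exactly
  rather than as a lower bound, so that the events for different \<open>X\<close> are disjoint and
  their probabilities can be added.\<close>

lemma measure_tree_event:
  assumes \<sigma>: "\<sigma> \<in> trajs T"
  shows "\<P>(f in law \<theta> (tree k n). (\<forall>t\<le>T. dyn (tree k n) u f t [] = \<sigma> t) \<and>
        (\<forall>x\<in>{1..n}. (\<forall>t\<le>T. dyn (tree k n) u f t [x] = s x t) \<and> (alt_core k b d (dyn (tree k n) u f T) [x] \<longleftrightarrow> x \<in> X)))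
    = pmf (spin_pmf \<theta>) (\<sigma> 0) * (\<Prod>t<T. kernel (Suc n) (u t) (\<sigma> (t + 1)) (\<lambda>x. s x t)) *
      (\<Prod>x\<in>{1..n}. \<P>(g in law \<theta> (rooted_tree k). (\<forall>t\<le>T. dyn (rooted_tree k) \<sigma> g t [] = s x t) \<and>
        (alt_core k b d (dyn (rooted_tree k) \<sigma> g T) [] \<longleftrightarrow> x \<in> X)))"
proof -
  let ?N = "law \<theta> (tree k n)" and ?L = "law \<theta> (rooted_tree k)" and ?I = "{[]} \<times> (UNIV :: nat set)"
  define R where "R = {f \<in> space (PiM ?I (site \<theta>)). root_ok n T u \<sigma> s f}"
  define Q where "Q x = {g \<in> space ?L. (\<forall>t\<le>T. dyn (rooted_tree k) \<sigma> g t [] = s x t) \<and>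
      (alt_core k b d (dyn (rooted_tree k) \<sigma> g T) [] \<longleftrightarrow> x \<in> X)}" for x
  have Q: "Q x \<in> sets ?L" for x
    unfolding Q_def
    by (rule sets_Collect_and[OF traj_measurable[OF rooted_Nil] sets_Collect_iff_const[OF rooted_alt_core_measurable]])
  have R: "restrict f ?I \<in> R \<longleftrightarrow> root_ok n T u \<sigma> s f" for f
    by (simp add: R_def root_ok_def space_PiM)
  have Qf: "branch k x f \<in> Q x \<longleftrightarrow> (\<forall>t\<le>T. dyn (rooted_tree k) \<sigma> (branch k x f) t [] = s x t) \<and>
      (alt_core k b d (dyn (rooted_tree k) \<sigma> (branch k x f) T) [] \<longleftrightarrow> x \<in> X)" for x f
    by (simp add: Q_def law_def space_PiM branch_def)
  have "(\<forall>t\<le>T. dyn (tree k n) u f t [] = \<sigma> t) \<and>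
        (\<forall>x\<in>{1..n}. (\<forall>t\<le>T. dyn (tree k n) u f t [x] = s x t) \<and> (alt_core k b d (dyn (tree k n) u f T) [x] \<longleftrightarrow> x \<in> X))
      \<longleftrightarrow> restrict f ?I \<in> R \<and> (\<forall>x\<in>{1..n}. branch k x f \<in> Q x)" (is "?l \<longleftrightarrow> ?r") for f
  proof -
    let ?tr = "\<forall>t\<le>T. dyn (tree k n) u f t [] = \<sigma> t"
    let ?S = "\<lambda>x. alt_core k b d (dyn (tree k n) u f T) [x] \<longleftrightarrow> x \<in> X"
    let ?S' = "\<lambda>x. alt_core k b d (dyn (rooted_tree k) \<sigma> (branch k x f) T) [] \<longleftrightarrow> x \<in> X"
    have S: "?S x \<longleftrightarrow> ?S' x" if ?tr "x \<in> {1..n}" for x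
      using alt_core_branch[of T k n u f \<sigma> x b d] that by (metis less_imp_le_nat)
    have "?l \<longleftrightarrow> (?tr \<and> (\<forall>x\<in>{1..n}. \<forall>t\<le>T. dyn (tree k n) u f t [x] = s x t)) \<and> (\<forall>x\<in>{1..n}. ?S' x)"
      using S by blast
    also have "\<dots> \<longleftrightarrow> ?r" unfolding dyn_tree_iff R Qf by blast
    finally show ?thesis .
  qed
  then have "\<P>(f in ?N. (\<forall>t\<le>T. dyn (tree k n) u f t [] = \<sigma> t) \<and>
        (\<forall>x\<in>{1..n}. (\<forall>t\<le>T. dyn (tree k n) u f t [x] = s x t) \<and> (alt_core k b d (dyn (tree k n) u f T) [x] \<longleftrightarrow> x \<in> X)))
      = \<P>(f in ?N. restrict f ?I \<in> R \<and> (\<forall>x\<in>{1..n}. branch k x f \<in> Q x))"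
    by (simp only:)
  also have "\<dots> = measure (PiM ?I (site \<theta>)) R * (\<Prod>x\<in>{1..n}. measure ?L (Q x))"
    by (rule measure_tree_blocks[OF measure_root_block(1)[OF \<sigma>, of \<theta> n u s, folded R_def] Q])
  also have "measure (PiM ?I (site \<theta>)) R
      = pmf (spin_pmf \<theta>) (\<sigma> 0) * (\<Prod>t<T. kernel (Suc n) (u t) (\<sigma> (t + 1)) (\<lambda>x. s x t))"
    unfolding R_def by (rule measure_root_block(2)[OF \<sigma>])
  finally show ?thesis unfolding Q_def .
qed

section \<open>The recursion\<close>

text \<open>The probabilistic meaning of the recursion: \<open>True\<close> will correspond to
  \<open>psi_odd\<close> and \<open>False\<close> to \<open>psi_even\<close>.\<close>

definition psi :: "nat \<Rightarrow> real \<Rightarrow> nat \<Rightarrow> bool \<Rightarrow> nat \<Rightarrow> (nat \<Rightarrow> int) \<Rightarrow> (nat \<Rightarrow> int) \<Rightarrow> real" where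
  "psi k \<theta> T b d \<sigma> u = \<P>(f in law \<theta> (rooted_tree k).
     (\<forall>t\<le>T. dyn (rooted_tree k) u f t [] = \<sigma> t) \<and> alt_core k b d (dyn (rooted_tree k) u f T) [])"

lemma root_prob_eq:
  "root_prob k \<theta> T \<sigma> u = \<P>(f in law \<theta> (rooted_tree k). \<forall>t\<le>T. dyn (rooted_tree k) u f t [] = \<sigma> t)"
proof -
  have "root_prob k \<theta> T \<sigma> u = \<P>(\<omega> in sample_space \<theta> (rooted_tree k).
      \<forall>t\<le>T. dyn (rooted_tree k) u (fresh_coins (rooted_tree k) u (\<lambda>i. i \<noteq> []) \<omega>) t [] = \<sigma> t)"
    unfolding root_prob_def field_majority_eq_sample_dyn dyn_fresh_coins[OF rooted_Nil] ..
  also have "\<dots> = \<P>(f in law \<theta> (rooted_tree k). \<forall>t\<le>T. dyn (rooted_tree k) u f t [] = \<sigma> t)"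
    by (rule measure_law_eq_sample[OF traj_measurable[OF rooted_Nil], symmetric])
  finally show ?thesis .
qed

lemma psi_measurable:
  "{f \<in> space (law \<theta> (rooted_tree k)). (\<forall>t\<le>T. dyn (rooted_tree k) u f t [] = \<sigma> t)
     \<and> alt_core k b d (dyn (rooted_tree k) u f T) []} \<in> sets (law \<theta> (rooted_tree k))"
  by (rule sets_Collect_and[OF traj_measurable[OF rooted_Nil] rooted_alt_core_measurable])

text \<open>Interprets the difference factors of \<open>psi_step\<close>: they belong to the
  children without the structure.\<close>

lemma root_prob_minus_psi:
  "root_prob k \<theta> T \<sigma> u - psi k \<theta> T b d \<sigma> u = \<P>(f in law \<theta> (rooted_tree k).
     (\<forall>t\<le>T. dyn (rooted_tree k) u f t [] = \<sigma> t) \<and> \<not> alt_core k b d (dyn (rooted_tree k) u f T) [])"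
proof -
  let ?L = "law \<theta> (rooted_tree k)"
  define A where "A = {f \<in> space ?L. \<forall>t\<le>T. dyn (rooted_tree k) u f t [] = \<sigma> t}"
  define B where "B = {f \<in> space ?L. (\<forall>t\<le>T. dyn (rooted_tree k) u f t [] = \<sigma> t) \<and> alt_core k b d (dyn (rooted_tree k) u f T) []}"
  interpret prob_space ?L by (rule prob_space_law)
  have "A \<in> events" unfolding A_def by (rule traj_measurable[OF rooted_Nil])
  moreover have "B \<in> events" unfolding B_def by (rule psi_measurable)
  moreover have "B \<subseteq> A" unfolding A_def B_def by blast
  ultimately have "prob (A - B) = prob A - prob B" by (rule finite_measure_Diff)
  moreover have "A - B = {f \<in> space ?L. (\<forall>t\<le>T. dyn (rooted_tree k) u f t [] = \<sigma> t) \<and> \<not> alt_core k b d (dyn (rooted_tree k) u f T) []}"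
    unfolding A_def B_def by blast
  ultimately show ?thesis by (simp only: root_prob_eq psi_def A_def[symmetric] B_def[symmetric])
qed

lemma psi_0: "psi k \<theta> T b 0 \<sigma> u = (if b then root_prob k \<theta> T \<sigma> u else root_prob k \<theta> T \<sigma> u * of_bool (\<sigma> T = - 1))"
proof -
  have "(\<forall>t\<le>T. dyn (rooted_tree k) u f t [] = \<sigma> t) \<and> alt_core k b 0 (dyn (rooted_tree k) u f T) []
      \<longleftrightarrow> (\<forall>t\<le>T. dyn (rooted_tree k) u f t [] = \<sigma> t) \<and> (b \<or> \<sigma> T = - 1)" (is "?tr f \<and> _ \<longleftrightarrow> _") for f
  proof (cases "?tr f")
    case True
    then have "dyn (rooted_tree k) u f T [] = \<sigma> T" by (rule allE[of _ T]) (erule mp, rule order_refl)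
    then show ?thesis unfolding alt_core.simps(1) by (simp only:)
  qed (simp only: simp_thms)
  then have "psi k \<theta> T b 0 \<sigma> u = \<P>(f in law \<theta> (rooted_tree k). (\<forall>t\<le>T. dyn (rooted_tree k) u f t [] = \<sigma> t) \<and> (b \<or> \<sigma> T = - 1))"
    by (simp only: psi_def)
  then show ?thesis by (cases b; cases "\<sigma> T = - 1") (simp_all add: root_prob_eq)
qed

lemma psi_antimono: "psi k \<theta> T b (Suc d) \<sigma> u \<le> psi k \<theta> T b d \<sigma> u"
proof -
  interpret prob_space "law \<theta> (rooted_tree k)" by (rule prob_space_law)
  show ?thesis unfolding psi_def
  proof (rule finite_measure_mono[OF Collect_mono psi_measurable], intro impI, elim conjE, intro conjI)
    show "alt_core k b d (dyn (rooted_tree k) u f T) []" if "alt_core k b (Suc d) (dyn (rooted_tree k) u f T) []" for f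
      using that by (rule alt_core_Suc_imp)
  qed assumption+
qed

text \<open>The event is partitioned by the exact set \<open>X\<close> of children carrying the
  structure and by the trajectories \<open>s\<close> of all children; each piece is then a product
  over root and branches.\<close>

lemma psi_Suc_sum:
  assumes "k \<ge> 1" and \<sigma>: "\<sigma> \<in> trajs T"
  shows "psi k \<theta> T b (Suc d) \<sigma> u = of_bool (b \<or> \<sigma> T = - 1) *
    (\<Sum>X | X \<subseteq> {1..k - 1} \<and> k div 2 \<le> card X. \<Sum>s \<in> {1..k - 1} \<rightarrow>\<^sub>E trajs T.
       pmf (spin_pmf \<theta>) (\<sigma> 0) * (\<Prod>t<T. kernel k (u t) (\<sigma> (t + 1)) (\<lambda>x. s x t)) *
       (\<Prod>x\<in>{1..k - 1}. if x \<in> X then psi k \<theta> T (\<not> b) d (s x) \<sigma>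
          else root_prob k \<theta> T (s x) \<sigma> - psi k \<theta> T (\<not> b) d (s x) \<sigma>))"
proof -
  define n where "n = k - 1"
  have k: "Suc n = k" using assms(1) by (simp add: n_def)
  let ?V = "tree k n"
  have V: "rooted_tree k = ?V" by (simp add: rooted_tree_eq n_def)
  interpret prob_space "law \<theta> ?V" by (rule prob_space_law)
  define S where "S f x \<longleftrightarrow> alt_core k (\<not> b) d (dyn ?V u f T) [x]" for f x
  define tr where "tr f \<longleftrightarrow> (\<forall>t\<le>T. dyn ?V u f t [] = \<sigma> t)" for f
  define ob where "ob f s \<longleftrightarrow> (\<forall>x\<in>{1..n}. \<forall>t\<le>T. dyn ?V u f t [x] = s x t)" for f s
  define I where "I = {X. X \<subseteq> {1..n} \<and> k div 2 \<le> card X} \<times> ({1..n} \<rightarrow>\<^sub>E trajs T)"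
  define P where "P i f \<longleftrightarrow> tr f \<and> (\<forall>x\<in>{1..n}. (\<forall>t\<le>T. dyn ?V u f t [x] = snd i x t) \<and> (S f x \<longleftrightarrow> x \<in> fst i))"
    for i :: "nat set \<times> (nat \<Rightarrow> nat \<Rightarrow> int)" and f
  define Q where "Q f \<longleftrightarrow> tr f \<and> k div 2 \<le> card {x \<in> {1..n}. S f x}" for f
  have fin_trajs: "finite (trajs T)" by (simp add: trajs_def finite_PiE)
  have finI: "finite I" unfolding I_def using fin_trajs
    by (intro finite_cartesian_product finite_PiE) auto
  have Smeas: "{f \<in> space (law \<theta> ?V). S f x} \<in> events" if "x \<in> {1..n}" for x
    unfolding S_def using that by (rule tree_alt_core_measurable)
  have trmeas: "{f \<in> space (law \<theta> ?V). tr f} \<in> events"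
    unfolding tr_def by (rule traj_measurable) simp
  have Pmeas: "{f \<in> space (law \<theta> ?V). P i f} \<in> events" for i
    unfolding P_def
  proof (rule sets_Collect_and[OF trmeas], rule sets.sets_Collect_finite_All)
    fix x assume x: "x \<in> {1..n}"
    show "{f \<in> space (law \<theta> ?V). (\<forall>t\<le>T. dyn ?V u f t [x] = snd i x t) \<and> (S f x \<longleftrightarrow> x \<in> fst i)} \<in> events"
      using x by (intro sets_Collect_and traj_measurable sets_Collect_iff_const Smeas) simp_all
  qed simp
  \<comment> \<open>A matching index exists once all spins lie in \<open>{- 1, 1}\<close>, which
    holds almost surely; it is unique because the indices are extensional functions.\<close>
  have AE1: "AE f in law \<theta> ?V. Q f \<longrightarrow> (\<exists>!i\<in>I. P i f)"
    using AE_law_values[where \<theta> = \<theta> and V = ?V]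
  proof eventually_elim
    case (elim f)
    show ?case
    proof
      assume Q: "Q f"
      let ?i = "({x \<in> {1..n}. S f x}, \<lambda>x\<in>{1..n}. \<lambda>t\<in>{0..T}. dyn ?V u f t [x])"
      have "?i \<in> I \<and> P ?i f"
        using Q dyn_values[OF elim] by (auto simp: I_def P_def Q_def trajs_def)
      moreover have "i = ?i" if i: "i \<in> I \<and> P i f" for i
      proof (rule prod_eqI)
        show "fst i = fst ?i" using i by (auto simp: I_def P_def)
        show "snd i = snd ?i"
        proof (rule extensionalityI[of _ "{1..n}"])
          fix x assume x: "x \<in> {1..n}"
          show "snd i x = snd ?i x"
          proof (rule extensionalityI[of _ "{0..T}"])
            show "snd i x \<in> extensional {0..T}" using i x by (auto simp: I_def trajs_def PiE_iff)
          qed (use i x in \<open>auto simp: P_def\<close>)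
        qed (use i in \<open>auto simp: I_def PiE_iff\<close>)
      qed
      ultimately show "\<exists>!i\<in>I. P i f" by blast
    qed
  qed
  have PQ: "Q f" if "i \<in> I" "P i f" for i f
  proof -
    have "{x \<in> {1..n}. S f x} = fst i" using that by (auto simp: I_def P_def)
    then show ?thesis using that by (auto simp: I_def P_def Q_def)
  qed
  have Qmeas: "{f \<in> space (law \<theta> ?V). Q f} \<in> events"
  proof -
    have eq: "Q f \<longleftrightarrow> (\<exists>X\<in>{X. X \<subseteq> {1..n} \<and> k div 2 \<le> card X}. tr f \<and> (\<forall>x\<in>{1..n}. S f x \<longleftrightarrow> x \<in> X))" for f
    proof
      assume "Q f"
      then show "\<exists>X\<in>{X. X \<subseteq> {1..n} \<and> k div 2 \<le> card X}. tr f \<and> (\<forall>x\<in>{1..n}. S f x \<longleftrightarrow> x \<in> X)"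
        by (intro bexI[of _ "{x \<in> {1..n}. S f x}"]) (auto simp: Q_def)
    next
      assume "\<exists>X\<in>{X. X \<subseteq> {1..n} \<and> k div 2 \<le> card X}. tr f \<and> (\<forall>x\<in>{1..n}. S f x \<longleftrightarrow> x \<in> X)"
      then obtain X where X: "X \<subseteq> {1..n}" "k div 2 \<le> card X" "tr f" "\<forall>x\<in>{1..n}. S f x \<longleftrightarrow> x \<in> X" by blast
      then have "{x \<in> {1..n}. S f x} = X" by auto
      with X show "Q f" by (simp add: Q_def)
    qed
    show ?thesis unfolding eq
    proof (rule sets.sets_Collect_finite_Ex)
      fix X
      show "{f \<in> space (law \<theta> ?V). tr f \<and> (\<forall>x\<in>{1..n}. S f x \<longleftrightarrow> x \<in> X)} \<in> events"
        by (intro sets_Collect_and trmeas sets.sets_Collect_finite_All sets_Collect_iff_const Smeas) simp_all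
    qed simp
  qed
  have "\<P>(f in law \<theta> ?V. Q f) = (\<Sum>i\<in>I. \<P>(f in law \<theta> ?V. P i f))"
    by (rule prob_sum[OF finI Pmeas Qmeas]) (use AE1 PQ in \<open>auto elim: eventually_mono\<close>)
  also have "\<dots> = (\<Sum>i\<in>I. pmf (spin_pmf \<theta>) (\<sigma> 0) * (\<Prod>t<T. kernel k (u t) (\<sigma> (t + 1)) (\<lambda>x. snd i x t)) *
       (\<Prod>x\<in>{1..n}. if x \<in> fst i then psi k \<theta> T (\<not> b) d (snd i x) \<sigma>
          else root_prob k \<theta> T (snd i x) \<sigma> - psi k \<theta> T (\<not> b) d (snd i x) \<sigma>))"
  proof (rule sum.cong[OF refl])
    fix i assume "i \<in> I"
    have "\<P>(f in law \<theta> ?V. P i f) = pmf (spin_pmf \<theta>) (\<sigma> 0) * (\<Prod>t<T. kernel (Suc n) (u t) (\<sigma> (t + 1)) (\<lambda>x. snd i x t)) *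
      (\<Prod>x\<in>{1..n}. \<P>(g in law \<theta> (rooted_tree k). (\<forall>t\<le>T. dyn (rooted_tree k) \<sigma> g t [] = snd i x t) \<and>
        (alt_core k (\<not> b) d (dyn (rooted_tree k) \<sigma> g T) [] \<longleftrightarrow> x \<in> fst i)))"
      unfolding P_def tr_def S_def by (rule measure_tree_event[OF \<sigma>])
    moreover have "\<P>(g in law \<theta> (rooted_tree k). (\<forall>t\<le>T. dyn (rooted_tree k) \<sigma> g t [] = snd i x t) \<and>
        (alt_core k (\<not> b) d (dyn (rooted_tree k) \<sigma> g T) [] \<longleftrightarrow> x \<in> fst i))
      = (if x \<in> fst i then psi k \<theta> T (\<not> b) d (snd i x) \<sigma>
          else root_prob k \<theta> T (snd i x) \<sigma> - psi k \<theta> T (\<not> b) d (snd i x) \<sigma>)" for x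
      unfolding root_prob_minus_psi unfolding psi_def by (cases "x \<in> fst i") (simp_all only: simp_thms if_True if_False)
    ultimately show "\<P>(f in law \<theta> ?V. P i f) = pmf (spin_pmf \<theta>) (\<sigma> 0) * (\<Prod>t<T. kernel k (u t) (\<sigma> (t + 1)) (\<lambda>x. snd i x t)) *
       (\<Prod>x\<in>{1..n}. if x \<in> fst i then psi k \<theta> T (\<not> b) d (snd i x) \<sigma>
          else root_prob k \<theta> T (snd i x) \<sigma> - psi k \<theta> T (\<not> b) d (snd i x) \<sigma>)"
      by (simp only: k)
  qed
  also have "\<dots> = (\<Sum>X | X \<subseteq> {1..n} \<and> k div 2 \<le> card X. \<Sum>s \<in> {1..n} \<rightarrow>\<^sub>E trajs T.
       pmf (spin_pmf \<theta>) (\<sigma> 0) * (\<Prod>t<T. kernel k (u t) (\<sigma> (t + 1)) (\<lambda>x. s x t)) *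
       (\<Prod>x\<in>{1..n}. if x \<in> X then psi k \<theta> T (\<not> b) d (s x) \<sigma>
          else root_prob k \<theta> T (s x) \<sigma> - psi k \<theta> T (\<not> b) d (s x) \<sigma>))"
    unfolding I_def by (subst sum.cartesian_product) (simp add: case_prod_unfold)
  finally have main: "\<P>(f in law \<theta> ?V. Q f) = \<dots>" .
  have "psi k \<theta> T b (Suc d) \<sigma> u = \<P>(f in law \<theta> ?V. (b \<or> \<sigma> T = - 1) \<and> Q f)"
  proof -
    have "(\<forall>t\<le>T. dyn ?V u f t [] = \<sigma> t) \<and> alt_core k b (Suc d) (dyn ?V u f T) [] \<longleftrightarrow> (b \<or> \<sigma> T = - 1) \<and> Q f" for f
      by (auto simp: Q_def tr_def S_def n_def)
    then show ?thesis by (simp only: psi_def V)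
  qed
  also have "\<dots> = of_bool (b \<or> \<sigma> T = - 1) * \<P>(f in law \<theta> ?V. Q f)"
    by (cases "b \<or> \<sigma> T = - 1") simp_all
  finally show ?thesis by (simp only: main n_def[symmetric])
qed

lemma ceiling_half: "nat \<lceil>(real k + 1) / 2\<rceil> - 1 = k div 2"
proof -
  have "\<lceil>(real k + 1) / 2\<rceil> = int (k div 2) + 1"
  proof (cases "even k")
    case True
    then obtain j where "k = 2 * j" by (elim evenE)
    then show ?thesis by (intro ceiling_unique) (simp_all add: field_simps)
  next
    case False
    then obtain j where "k = 2 * j + 1" by (elim oddE)
    then show ?thesis by (intro ceiling_unique) (simp_all add: field_simps)
  qed
  then show ?thesis by simp
qed

text \<open>
  A permutation of the children moves the selected set to an initial segment, which is
  where the binomial coefficients in \<^const>\<open>psi_step\<close> come from.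
\<close>

lemma sum_select_subset:
  fixes W :: "(nat \<Rightarrow> 'a) \<Rightarrow> real" and F G :: "'a \<Rightarrow> real"
  assumes X: "X \<subseteq> {1..n}"
    and W: "\<And>s \<pi>. bij_betw \<pi> {1..n} {1..n} \<Longrightarrow> W (\<lambda>i\<in>{1..n}. s (\<pi> i)) = W s"
  shows "(\<Sum>s\<in>{1..n} \<rightarrow>\<^sub>E D. W s * (\<Prod>i\<in>{1..n}. if i \<in> X then F (s i) else G (s i)))
    = (\<Sum>s\<in>{1..n} \<rightarrow>\<^sub>E D. W s * (\<Prod>i=1..card X. F (s i)) * (\<Prod>i=card X + 1..n. G (s i)))"
proof -
  define r where "r = card X"
  have fX: "finite X" using X by (rule finite_subset) simp
  have r: "r \<le> n" using card_mono[OF _ X] by (simp add: r_def)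
  obtain f where f: "bij_betw f {1..r} X"
    using finite_same_card_bij[of "{1..r}" X] fX by (auto simp: r_def)
  have "card {r + 1..n} = card ({1..n} - X)"
    using X fX by (simp add: card_Diff_subset r_def)
  then obtain g where g: "bij_betw g {r + 1..n} ({1..n} - X)"
    using finite_same_card_bij[of "{r + 1..n}" "{1..n} - X"] by auto
  define \<pi> where "\<pi> i = (if i \<in> {1..r} then f i else g i)" for i
  have "bij_betw \<pi> {1..r} X" using f by (rule bij_betw_cong[THEN iffD1, rotated]) (simp add: \<pi>_def)
  moreover have "bij_betw \<pi> {r + 1..n} ({1..n} - X)"
    using g by (rule bij_betw_cong[THEN iffD1, rotated]) (simp add: \<pi>_def)
  ultimately have "bij_betw \<pi> ({1..r} \<union> {r + 1..n}) (X \<union> ({1..n} - X))"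
    by (rule bij_betw_combine) auto
  moreover have un: "{1..r} \<union> {r + 1..n} = {1..n}" "X \<union> ({1..n} - X) = {1..n}" using r X by auto
  ultimately have \<pi>: "bij_betw \<pi> {1..n} {1..n}" by (simp only:)
  define \<rho> where "\<rho> = the_inv_into {1..n} \<pi>"
  have \<rho>: "bij_betw \<rho> {1..n} {1..n}" unfolding \<rho>_def by (rule bij_betw_the_inv_into[OF \<pi>])
  have inv1: "\<pi> (\<rho> i) = i" if "i \<in> {1..n}" for i
    unfolding \<rho>_def using that \<pi> by (intro f_the_inv_into_f_bij_betw)
  have inv2: "\<rho> (\<pi> i) = i" if "i \<in> {1..n}" for i
    unfolding \<rho>_def using that \<pi> by (intro the_inv_into_f_f) (auto simp: bij_betw_def)
  have \<pi>in: "\<pi> i \<in> {1..n}" and \<rho>in: "\<rho> i \<in> {1..n}" if "i \<in> {1..n}" for i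
    using that bij_betwE[OF \<pi>] bij_betwE[OF \<rho>] by blast+
  have mem: "\<pi> i \<in> X \<longleftrightarrow> i \<le> r" if "i \<in> {1..n}" for i
    using that bij_betwE[OF f] bij_betwE[OF g] by (cases "i \<le> r") (auto simp: \<pi>_def)
  have "(\<Sum>s\<in>{1..n} \<rightarrow>\<^sub>E D. W s * (\<Prod>i\<in>{1..n}. if i \<in> X then F (s i) else G (s i)))
      = (\<Sum>s\<in>{1..n} \<rightarrow>\<^sub>E D. W s * (\<Prod>i=1..r. F (s i)) * (\<Prod>i=r + 1..n. G (s i)))"
  proof (rule sum.reindex_bij_witness)
    fix s assume s: "s \<in> {1..n} \<rightarrow>\<^sub>E D"
    show "(\<lambda>i\<in>{1..n}. s (\<pi> i)) \<in> {1..n} \<rightarrow>\<^sub>E D" "(\<lambda>i\<in>{1..n}. s (\<rho> i)) \<in> {1..n} \<rightarrow>\<^sub>E D"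
      using s \<pi>in \<rho>in by (auto simp: PiE_iff)
    show "(\<lambda>i\<in>{1..n}. (\<lambda>i\<in>{1..n}. s (\<pi> i)) (\<rho> i)) = s"
      by (rule extensionalityI[of _ "{1..n}"]) (use s \<rho>in inv1 in \<open>auto simp: PiE_iff\<close>)
    show "(\<lambda>i\<in>{1..n}. (\<lambda>i\<in>{1..n}. s (\<rho> i)) (\<pi> i)) = s"
      by (rule extensionalityI[of _ "{1..n}"]) (use s \<pi>in inv2 in \<open>auto simp: PiE_iff\<close>)
    let ?s' = "\<lambda>i\<in>{1..n}. s (\<pi> i)"
    have "(\<Prod>i\<in>{1..n}. if i \<in> X then F (s i) else G (s i))
        = (\<Prod>i\<in>{1..n}. if \<pi> i \<in> X then F (s (\<pi> i)) else G (s (\<pi> i)))"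
      by (rule prod.reindex_bij_betw[OF \<pi>, symmetric])
    also have "\<dots> = (\<Prod>i\<in>{1..n}. if i \<le> r then F (?s' i) else G (?s' i))"
      using mem by (intro prod.cong) auto
    also have "\<dots> = (\<Prod>i\<in>{1..r}. if i \<le> r then F (?s' i) else G (?s' i))
        * (\<Prod>i\<in>{r + 1..n}. if i \<le> r then F (?s' i) else G (?s' i))"
      unfolding un(1)[symmetric] by (rule prod.union_disjoint) auto
    also have "\<dots> = (\<Prod>i=1..r. F (?s' i)) * (\<Prod>i=r + 1..n. G (?s' i))"
      by (intro arg_cong2[where f = "(*)"] prod.cong) auto
    finally show "W ?s' * (\<Prod>i=1..r. F (?s' i)) * (\<Prod>i=r + 1..n. G (?s' i))
        = W s * (\<Prod>i\<in>{1..n}. if i \<in> X then F (s i) else G (s i))"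
      using W[OF \<pi>, of s] by (simp only: mult.assoc)
  qed
  then show ?thesis by (simp only: r_def)
qed

lemma psi_step_eq:
  "psi_step k \<theta> T \<Phi> \<sigma> u =
    (\<Sum>X | X \<subseteq> {1..k - 1} \<and> k div 2 \<le> card X. \<Sum>s \<in> {1..k - 1} \<rightarrow>\<^sub>E trajs T.
       pmf (spin_pmf \<theta>) (\<sigma> 0) * (\<Prod>t<T. kernel k (u t) (\<sigma> (t + 1)) (\<lambda>x. s x t)) *
       (\<Prod>x\<in>{1..k - 1}. if x \<in> X then \<Phi> (s x) \<sigma> else root_prob k \<theta> T (s x) \<sigma> - \<Phi> (s x) \<sigma>))"
proof -
  let ?S = "{X. X \<subseteq> {1..k - 1} \<and> k div 2 \<le> card X}"
  let ?W = "\<lambda>s. \<Prod>t<T. kernel k (u t) (\<sigma> (t + 1)) (\<lambda>x. s x t)"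
  define c where "c r = (\<Sum>s \<in> {1..k - 1} \<rightarrow>\<^sub>E trajs T. ?W s * (\<Prod>i=1..r. \<Phi> (s i) \<sigma>) *
    (\<Prod>i=r + 1..k - 1. root_prob k \<theta> T (s i) \<sigma> - \<Phi> (s i) \<sigma>))" for r
  \<comment> \<open>The kernel sees the children through their sum, so it is invariant under
    permutations of them.\<close>
  have W: "?W (\<lambda>i\<in>{1..k - 1}. s (\<pi> i)) = ?W s" if \<pi>: "bij_betw \<pi> {1..k - 1} {1..k - 1}" for s \<pi>
  proof (rule prod.cong[OF refl])
    fix t
    have "(\<Sum>i=1..k - 1. (\<lambda>i\<in>{1..k - 1}. s (\<pi> i)) i t) = (\<Sum>i=1..k - 1. s (\<pi> i) t)"
      by (intro sum.cong) auto
    also have "\<dots> = (\<Sum>i=1..k - 1. s i t)"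
      by (rule sum.reindex_bij_betw[OF \<pi>])
    finally show "kernel k (u t) (\<sigma> (t + 1)) (\<lambda>x. (\<lambda>i\<in>{1..k - 1}. s (\<pi> i)) x t) = kernel k (u t) (\<sigma> (t + 1)) (\<lambda>x. s x t)"
      unfolding kernel_def by (simp only:)
  qed
  have cX: "(\<Sum>s \<in> {1..k - 1} \<rightarrow>\<^sub>E trajs T. ?W s *
       (\<Prod>x\<in>{1..k - 1}. if x \<in> X then \<Phi> (s x) \<sigma> else root_prob k \<theta> T (s x) \<sigma> - \<Phi> (s x) \<sigma>)) = c (card X)"
    if "X \<subseteq> {1..k - 1}" for X
    unfolding c_def by (rule sum_select_subset[where W = ?W, OF that]) (rule W)
  have fin: "finite ?S" by (rule finite_subset[of _ "Pow {1..k - 1}"]) auto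
  \<comment> \<open>Grouping by cardinality turns the sum over sets into binomial
    coefficients.\<close>
  have "(\<Sum>X\<in>?S. c (card X)) = (\<Sum>r=k div 2..k - 1. \<Sum>X\<in>{X \<in> ?S. card X = r}. c (card X))"
  proof (rule sum.group[symmetric])
    show "card ` ?S \<subseteq> {k div 2..k - 1}" using card_mono[of "{1..k - 1}"] by fastforce
  qed (use fin in simp_all)
  also have "\<dots> = (\<Sum>r=k div 2..k - 1. real ((k - 1) choose r) * c r)"
  proof (rule sum.cong[OF refl])
    fix r assume "r \<in> {k div 2..k - 1}"
    then have "{X \<in> ?S. card X = r} = {X. X \<subseteq> {1..k - 1} \<and> card X = r}" by auto
    then have "(\<Sum>X\<in>{X \<in> ?S. card X = r}. c (card X)) = (\<Sum>X | X \<subseteq> {1..k - 1} \<and> card X = r. c r)"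
      by (intro sum.cong) auto
    also have "\<dots> = real ((k - 1) choose r) * c r"
      using n_subsets[of "{1..k - 1}" r] by simp
    finally show "(\<Sum>X\<in>{X \<in> ?S. card X = r}. c (card X)) = real ((k - 1) choose r) * c r" .
  qed
  finally have sum_c: "(\<Sum>X\<in>?S. c (card X)) = (\<Sum>r=k div 2..k - 1. real ((k - 1) choose r) * c r)" .
  have "psi_step k \<theta> T \<Phi> \<sigma> u = pmf (spin_pmf \<theta>) (\<sigma> 0) * (\<Sum>r=k div 2..k - 1. real ((k - 1) choose r) * c r)"
    unfolding psi_step_def ceiling_half c_def ..
  also have "(\<Sum>r=k div 2..k - 1. real ((k - 1) choose r) * c r) = (\<Sum>X\<in>?S. c (card X))"
    by (rule sum_c[symmetric])
  also have "(\<Sum>X\<in>?S. c (card X)) = (\<Sum>X\<in>?S. \<Sum>s \<in> {1..k - 1} \<rightarrow>\<^sub>E trajs T. ?W s *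
       (\<Prod>x\<in>{1..k - 1}. if x \<in> X then \<Phi> (s x) \<sigma> else root_prob k \<theta> T (s x) \<sigma> - \<Phi> (s x) \<sigma>))"
    by (intro sum.cong refl cX[symmetric]) blast
  finally show ?thesis unfolding sum_distrib_left mult.assoc .
qed

text \<open>The recursion evaluates \<open>\<Phi>\<close> at trajectories in its first argument, and
  it is there that \<open>psi_odd\<close> and \<open>psi_even\<close> will be identified with
  \<open>psi\<close>.\<close>

lemma psi_step_cong:
  assumes "\<And>s. s \<in> trajs T \<Longrightarrow> \<Phi> s \<sigma> = \<Phi>' s \<sigma>"
  shows "psi_step k \<theta> T \<Phi> \<sigma> u = psi_step k \<theta> T \<Phi>' \<sigma> u"
proof -
  have "(if x \<in> X then \<Phi> (s x) \<sigma> else root_prob k \<theta> T (s x) \<sigma> - \<Phi> (s x) \<sigma>)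
      = (if x \<in> X then \<Phi>' (s x) \<sigma> else root_prob k \<theta> T (s x) \<sigma> - \<Phi>' (s x) \<sigma>)"
    if "s \<in> {1..k - 1} \<rightarrow>\<^sub>E trajs T" "x \<in> {1..k - 1}" for s x X
    using assms[of "s x"] PiE_mem[OF that] by simp
  then show ?thesis unfolding psi_step_eq
    by (intro sum.cong refl arg_cong2[where f = "(*)"] prod.cong) blast
qed

lemma psi_Suc_eq_step:
  assumes "k \<ge> 1" "\<sigma> \<in> trajs T"
  shows "psi k \<theta> T b (Suc d) \<sigma> u = of_bool (b \<or> \<sigma> T = - 1) * psi_step k \<theta> T (psi k \<theta> T (\<not> b) d) \<sigma> u"
  unfolding psi_step_eq by (rule psi_Suc_sum[OF assms])

lemma psi_odd_even_eq_psi: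
  assumes "k \<ge> 1"
  shows "\<sigma> \<in> trajs T \<Longrightarrow> psi_odd k \<theta> T d \<sigma> u = psi k \<theta> T True d \<sigma> u"
    and "\<sigma> \<in> trajs T \<Longrightarrow> psi_even k \<theta> T d \<sigma> u = psi k \<theta> T False d \<sigma> u"
proof (induction d arbitrary: \<sigma> u)
  case 0
  {
    case 1
    show ?case by (simp add: psi_0)
  next
    case 2
    show ?case by (simp add: psi_0)
  }
next
  case (Suc d)
  {
    case 1
    have "psi_odd k \<theta> T (Suc d) \<sigma> u = psi_step k \<theta> T (psi k \<theta> T False d) \<sigma> u"
      unfolding psi_odd.simps by (rule psi_step_cong) (rule Suc.IH(2))
    then show ?case by (simp add: psi_Suc_eq_step[OF assms 1])
  next
    case 2
    have "psi_even k \<theta> T (Suc d) \<sigma> u = of_bool (\<sigma> T = - 1) * psi_step k \<theta> T (psi k \<theta> T True d) \<sigma> u"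
      unfolding psi_even.simps by (intro arg_cong2[where f = "(*)"] refl psi_step_cong) (rule Suc.IH(1))
    then show ?case by (simp add: psi_Suc_eq_step[OF assms 2])
  }
qed

lemma psi_convergent: "convergent (\<lambda>d. psi k \<theta> T b d \<sigma> u)"
  and psi_ge_lim: "lim (\<lambda>d. psi k \<theta> T b d \<sigma> u) \<le> psi k \<theta> T b d \<sigma> u"
proof -
  have dec: "decseq (\<lambda>d. psi k \<theta> T b d \<sigma> u)"
    by (intro decseq_SucI psi_antimono)
  then obtain L where L: "(\<lambda>d. psi k \<theta> T b d \<sigma> u) \<longlonglongrightarrow> L"
    by (rule decseq_convergent[of _ 0]) (simp add: psi_def)
  then show "convergent (\<lambda>d. psi k \<theta> T b d \<sigma> u)" by (rule convergentI)
  show "lim (\<lambda>d. psi k \<theta> T b d \<sigma> u) \<le> psi k \<theta> T b d \<sigma> u"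
    using decseq_ge[OF dec L] limI[OF L] by simp
qed

section \<open>Failure of consensus\<close>

lemma regular_tree_nbrs:
  assumes v: "v \<in> regular_tree k" "v \<noteq> []"
  shows "tl v \<in> nbrs (regular_tree k) v" "x \<in> {1..k - 1} \<Longrightarrow> x # v \<in> nbrs (regular_tree k) v"
proof -
  obtain y w where yw: "v = y # w" using v(2) by (cases v) auto
  have "w \<in> regular_tree k"
    using v(1) unfolding yw by (cases "w = []") (auto simp: regular_tree_def)
  then show "tl v \<in> nbrs (regular_tree k) v" by (auto simp: nbrs_def yw)
  show "x # v \<in> nbrs (regular_tree k) v" if "x \<in> {1..k - 1}"
    using v that by (auto simp: nbrs_def regular_tree_def)
qed

lemma alt_core_imp_minus: "alt_core k False d \<eta> v \<Longrightarrow> \<eta> v = - 1"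
  by (cases d) auto

text \<open>The sum is at most \<open>k - 2 * (k div 2 + 1)\<close>, that is \<open>- 2\<close> for
  even and \<open>- 1\<close> for odd \<open>k\<close>. Hence \<open>k div 2\<close> is the least
  number of children that, with the parent, forces a strict majority.\<close>

lemma sum_nbrs_neg:
  assumes k: "k \<ge> 2" and v: "v \<in> regular_tree k" "v \<noteq> []"
    and le: "\<And>w. w \<in> regular_tree k \<Longrightarrow> \<eta> w \<le> (1 :: int)"
    and parent: "\<eta> (tl v) = - 1" and children: "k div 2 \<le> card {x \<in> {1..k - 1}. \<eta> (x # v) = - 1}"
  shows "(\<Sum>j\<in>nbrs (regular_tree k) v. \<eta> j) < 0"
proof -
  let ?N = "nbrs (regular_tree k) v" and ?C = "{x \<in> {1..k - 1}. \<eta> (x # v) = - 1}"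
  define S where "S = insert (tl v) ((\<lambda>x. x # v) ` ?C)"
  have card_N: "card ?N = k" by (rule card_nbrs_regular_tree[OF k v(1)])
  have fin_N: "finite ?N" using card_N k by (intro card_ge_0_finite) simp
  have S: "S \<subseteq> ?N" using regular_tree_nbrs[OF v] by (auto simp: S_def)
  have "tl v \<notin> (\<lambda>x. x # v) ` ?C" by (auto dest: arg_cong[where f = length])
  then have card_S: "card S = Suc (card ?C)"
    by (simp add: S_def card_image inj_on_def)
  have "(\<Sum>j\<in>?N. \<eta> j) = (\<Sum>j\<in>S. \<eta> j) + (\<Sum>j\<in>?N - S. \<eta> j)"
    using sum.subset_diff[OF S fin_N, of \<eta>] by simp
  moreover have "(\<Sum>j\<in>S. \<eta> j) = - int (card S)"
    using parent by (subst sum.cong[of S S _ "\<lambda>_. - 1"]) (auto simp: S_def)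
  moreover have "(\<Sum>j\<in>?N - S. \<eta> j) \<le> int (card (?N - S)) * 1"
    using le nbrs_subset by (intro sum_bounded_above) blast
  moreover have "card (?N - S) = k - card S"
    using card_Diff_subset[OF finite_subset[OF S fin_N] S] card_N by simp
  moreover have "card S \<le> k" using card_mono[OF fin_N S] card_N by simp
  ultimately show ?thesis using children card_S by linarith
qed

text \<open>
  A vertex of the odd class sees at least \<open>k div 2\<close> spins \<open>- 1\<close> among its children and one more
  at its parent, hence a strict majority of them.
\<close>

lemma alt_core_odd_step:
  assumes k: "k \<ge> 2" and f: "\<forall>p\<in>regular_tree k \<times> UNIV. f p \<in> {-1, 1}"
    and v: "v \<in> regular_tree k" "v \<noteq> []"
    and s: "alt_core k True (Suc d) (dyn (regular_tree k) u f t) v"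
    and p: "dyn (regular_tree k) u f t (tl v) = - 1"
  shows "dyn (regular_tree k) u f (Suc t) v = - 1"
proof -
  let ?\<eta> = "dyn (regular_tree k) u f t"
  have le: "?\<eta> w \<le> 1" if "w \<in> regular_tree k" for w
    using dyn_values[OF f that, of u t] by auto
  have "{x \<in> {1..k - 1}. alt_core k False d ?\<eta> (x # v)} \<subseteq> {x \<in> {1..k - 1}. ?\<eta> (x # v) = - 1}"
    using alt_core_imp_minus by blast
  then have "card {x \<in> {1..k - 1}. alt_core k False d ?\<eta> (x # v)} \<le> card {x \<in> {1..k - 1}. ?\<eta> (x # v) = - 1}"
    by (intro card_mono) auto
  moreover have "k div 2 \<le> card {x \<in> {1..k - 1}. alt_core k False d ?\<eta> (x # v)}" using s by simp
  ultimately have "(\<Sum>j\<in>nbrs (regular_tree k) v. ?\<eta> j) < 0"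
    by (intro sum_nbrs_neg[OF k v, of ?\<eta>, OF le p]) auto
  then show ?thesis using v(2) by (simp add: sgn_if)
qed

text \<open>One time step exchanges the two classes of the structure, at the cost of one level of depth.\<close>

lemma alt_core_step:
  assumes k: "k \<ge> 2" and f: "\<forall>p\<in>regular_tree k \<times> UNIV. f p \<in> {-1, 1}"
  shows "v \<in> regular_tree k \<Longrightarrow> v \<noteq> [] \<Longrightarrow> alt_core k b (Suc d) (dyn (regular_tree k) u f t) v \<Longrightarrow>
    (b \<longrightarrow> dyn (regular_tree k) u f t (tl v) = - 1) \<Longrightarrow> alt_core k (\<not> b) d (dyn (regular_tree k) u f (Suc t)) v"
proof (induction d arbitrary: b v)
  case 0
  then show ?case using alt_core_odd_step[OF k f 0(1,2), of 0 u t] by (cases b) (simp_all del: dyn.simps)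
next
  case (Suc d)
  let ?V = "regular_tree k"
  let ?\<eta> = "dyn ?V u f t" and ?\<eta>' = "dyn ?V u f (Suc t)"
  have s: "(b \<or> ?\<eta> v = - 1) \<and> k div 2 \<le> card {x \<in> {1..k - 1}. alt_core k (\<not> b) (Suc d) ?\<eta> (x # v)}"
    using Suc.prems(3) by (simp only: alt_core.simps(2)[of k b "Suc d"])
  have sub: "{x \<in> {1..k - 1}. alt_core k (\<not> b) (Suc d) ?\<eta> (x # v)} \<subseteq> {x \<in> {1..k - 1}. alt_core k b d ?\<eta>' (x # v)}"
  proof
    fix x assume "x \<in> {x \<in> {1..k - 1}. alt_core k (\<not> b) (Suc d) ?\<eta> (x # v)}"
    then have x: "x \<in> {1..k - 1}" "alt_core k (\<not> b) (Suc d) ?\<eta> (x # v)" by blast+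
    have "x # v \<in> ?V" using regular_tree_nbrs(2)[OF Suc.prems(1,2) x(1)] nbrs_subset by blast
    \<comment> \<open>The children of an even vertex are odd, and the parent whose spin they need is
      \<open>v\<close> itself, which is \<open>- 1\<close>.\<close>
    moreover have "\<not> b \<longrightarrow> ?\<eta> (tl (x # v)) = - 1" using conjunct1[OF s] by auto
    ultimately have "alt_core k (\<not> \<not> b) d ?\<eta>' (x # v)" using x(2) by (intro Suc.IH) simp_all
    then show "x \<in> {x \<in> {1..k - 1}. alt_core k b d ?\<eta>' (x # v)}" using x(1) by (simp del: dyn.simps)
  qed
  have "k div 2 \<le> card {x \<in> {1..k - 1}. alt_core k b d ?\<eta>' (x # v)}"
    using s card_mono[OF _ sub] by (auto simp del: dyn.simps)
  moreover have "?\<eta>' v = - 1" if b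
  proof (rule alt_core_odd_step[OF k f Suc.prems(1,2)])
    show "alt_core k True (Suc (Suc d)) ?\<eta> v" using Suc.prems(3) that by (simp only: simp_thms)
    show "?\<eta> (tl v) = - 1" using Suc.prems(4) that by blast
  qed
  ultimately show ?case by (simp del: dyn.simps)
qed

text \<open>One step makes all \<open>k\<close> neighbours even, hence \<open>- 1\<close>, and the
  next step makes the root \<open>- 1\<close> by unanimity. In between, the spin of the root is
  uncontrolled, but even vertices do not need their parent. The surplus depth \<open>d\<close> lets
  one deep structure serve all smaller \<open>j\<close>.\<close>

lemma root_minus:
  assumes k: "k \<ge> 2" and f: "\<forall>p\<in>regular_tree k \<times> UNIV. f p \<in> {-1, 1}"
  shows "dyn (regular_tree k) (\<lambda>_. 0) f t [] = - 1 \<Longrightarrow>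
    \<forall>x\<in>{1..k}. alt_core k True (d + 2 * j) (dyn (regular_tree k) (\<lambda>_. 0) f t) [x] \<Longrightarrow>
    dyn (regular_tree k) (\<lambda>_. 0) f (t + 2 * j) [] = - 1"
proof (induction j arbitrary: t)
  case 0
  then show ?case by simp
next
  case (Suc j)
  let ?V = "regular_tree k"
  let ?\<eta> = "dyn ?V (\<lambda>_. 0) f"
  have V: "[x] \<in> ?V" if "x \<in> {1..k}" for x using that by (simp add: regular_tree_eq)
  have 1: "\<forall>x\<in>{1..k}. alt_core k False (Suc (d + 2 * j)) (?\<eta> (Suc t)) [x]"
  proof
    fix x assume x: "x \<in> {1..k}"
    have s: "alt_core k True (Suc (Suc (d + 2 * j))) (?\<eta> t) [x]"
      using bspec[OF Suc.prems(2) x] by (simp only: mult_Suc_right numeral_2_eq_2 add_Suc_right add_Suc add_0)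
    have "alt_core k (\<not> True) (Suc (d + 2 * j)) (?\<eta> (Suc t)) [x]"
      by (rule alt_core_step[OF k f V[OF x] list.distinct(2) s]) (simp only: list.sel Suc.prems(1) simp_thms)
    then show "alt_core k False (Suc (d + 2 * j)) (?\<eta> (Suc t)) [x]" by (simp only: not_True_eq_False)
  qed
  have 2: "\<forall>x\<in>{1..k}. alt_core k True (d + 2 * j) (?\<eta> (Suc (Suc t))) [x]"
  proof
    fix x assume x: "x \<in> {1..k}"
    have s: "alt_core k False (Suc (d + 2 * j)) (?\<eta> (Suc t)) [x]" using 1 x by blast
    have "alt_core k (\<not> False) (d + 2 * j) (?\<eta> (Suc (Suc t))) [x]"
      by (rule alt_core_step[OF k f V[OF x] list.distinct(2) s]) (simp only: simp_thms)
    then show "alt_core k True (d + 2 * j) (?\<eta> (Suc (Suc t))) [x]" by (simp only: not_False_eq_True)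
  qed
  have "(\<Sum>j\<in>nbrs ?V []. ?\<eta> (Suc t) j) = (\<Sum>x=1..k. ?\<eta> (Suc t) [x])"
    unfolding regular_tree_eq by (rule sum_nbrs_tree_root)
  also have "\<dots> = (\<Sum>x=1..k. - 1)"
    using 1 by (intro sum.cong refl alt_core_imp_minus) blast
  also have "\<dots> < 0" using k by simp
  finally have "?\<eta> (Suc (Suc t)) [] = - 1"
    by (simp only: dyn.simps(2)[of ?V "\<lambda>_. 0" f "Suc t"] Let_def add_0_right if_cancel sgn_neg if_not_P) simp
  from Suc.IH[OF this 2] show ?case by simp
qed


lemma no_consensus:
  assumes k: "k \<ge> 2" and \<theta>: "\<theta> \<in> {0..1}"
    and pos: "\<And>\<sigma> u. \<sigma> \<in> trajs T \<Longrightarrow> u \<in> trajs T \<Longrightarrow> psi_odd_lim k \<theta> T \<sigma> u > 0"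
  shows "\<not> (AE f in law \<theta> (regular_tree k). consensus (regular_tree k) f)"
proof
  let ?V = "regular_tree k"
  let ?L = "law \<theta> ?V" and ?\<eta> = "\<lambda>f. dyn ?V (\<lambda>_. 0) f"
  assume cons: "AE f in ?L. consensus ?V f"
  interpret prob_space ?L by (rule prob_space_law)
  define \<sigma> where "\<sigma> = (\<lambda>t\<in>{0..T}. - 1 :: int)"
  have \<sigma>t: "\<sigma> t = - 1" if "t \<le> T" for t
    using that by (simp add: \<sigma>_def)
  have \<sigma>: "\<sigma> \<in> trajs T" by (auto simp: \<sigma>_def trajs_def)
  define c0 where "c0 = psi_odd_lim k \<theta> T \<sigma> \<sigma>"
  have c0: "c0 > 0" unfolding c0_def by (rule pos[OF \<sigma> \<sigma>])
  have psi_c0: "c0 \<le> psi k \<theta> T True d \<sigma> \<sigma>" for d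
    using psi_ge_lim[of k \<theta> T True \<sigma> \<sigma> d] psi_odd_even_eq_psi(1)[OF _ \<sigma>, of k \<theta> _ \<sigma>] k
    by (simp add: c0_def psi_odd_lim_def)
  define p where "p = pmf (spin_pmf \<theta>) (- 1)"
  \<comment> \<open>At \<open>\<theta> = 1\<close> the spin \<open>- 1\<close> has no mass.
    Positivity of the limit excludes this, since \<open>p\<close> is a factor of
    \<open>psi_step\<close>.\<close>
  have p: "p > 0"
  proof -
    have "psi k \<theta> T True (Suc 0) \<sigma> \<sigma> = psi_step k \<theta> T (psi k \<theta> T False 0) \<sigma> \<sigma>"
      using psi_Suc_eq_step[OF _ \<sigma>, of k \<theta> True 0 \<sigma>] k by simp
    then have "psi_step k \<theta> T (psi k \<theta> T False 0) \<sigma> \<sigma> > 0"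
      using psi_c0[of "Suc 0"] c0 by simp
    then have "p \<noteq> 0" unfolding psi_step_def p_def \<sigma>t[OF le0] by auto
    then show ?thesis using pmf_nonneg[of "spin_pmf \<theta>" "- 1"] by (simp add: p_def)
  qed
  \<comment> \<open>One factor for the initial spin of the root and one for each of its
    \<open>k\<close> branches; it does not depend on the depth.\<close>
  define c where "c = p * c0 ^ k"
  have c: "c > 0" using p c0 by (simp add: c_def)
  define B where "B J = {f \<in> space ?L. \<forall>j\<le>J. ?\<eta> f (T + 2 * j) [] = - 1}" for J
  have Vnil: "[] \<in> ?V" by (simp add: regular_tree_eq)
  have B: "B J \<in> events" for J unfolding B_def
  proof (rule sets.sets_Collect_countable_All)
    fix j show "{f \<in> space ?L. j \<le> J \<longrightarrow> ?\<eta> f (T + 2 * j) [] = - 1} \<in> events"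
      by (rule sets_Collect_discrete[OF measurable_dyn[OF Vnil], of \<theta> "\<lambda>a. j \<le> J \<longrightarrow> a = - 1"])
  qed
  have pB: "c \<le> prob (B J)" for J
  proof -
    \<comment> \<open>The root and all its neighbours stay at \<open>- 1\<close> up to time
      \<open>T\<close>. Then no tie occurs at the root and every kernel factor is 1.\<close>
    let ?E = "\<lambda>f. (\<forall>t\<le>T. ?\<eta> f t [] = \<sigma> t) \<and>
        (\<forall>x\<in>{1..k}. (\<forall>t\<le>T. ?\<eta> f t [x] = \<sigma> t) \<and> (alt_core k True (2 * J) (?\<eta> f T) [x] \<longleftrightarrow> x \<in> {1..k}))"
    have kern: "kernel (Suc k) 0 (\<sigma> (t + 1)) (\<lambda>x. \<sigma> t) = 1" if "t < T" for t
      using k that by (simp add: \<sigma>t kernel_def)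
    have "\<P>(g in law \<theta> (rooted_tree k). (\<forall>t\<le>T. dyn (rooted_tree k) \<sigma> g t [] = \<sigma> t) \<and>
        (alt_core k True (2 * J) (dyn (rooted_tree k) \<sigma> g T) [] \<longleftrightarrow> x \<in> {1..k})) = psi k \<theta> T True (2 * J) \<sigma> \<sigma>"
      if "x \<in> {1..k}" for x
      unfolding psi_def by (simp only: that simp_thms)
    then have "\<P>(f in ?L. ?E f) = p * (\<Prod>t<T. kernel (Suc k) 0 (\<sigma> (t + 1)) (\<lambda>x. \<sigma> t)) *
        (\<Prod>x\<in>{1..k}. psi k \<theta> T True (2 * J) \<sigma> \<sigma>)"
      unfolding regular_tree_eq measure_tree_event[OF \<sigma>, where s = "\<lambda>_. \<sigma>" and u = "\<lambda>_. 0"]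
      by (simp only: p_def \<sigma>t[OF le0] cong: prod.cong)
    also have "(\<Prod>t<T. kernel (Suc k) 0 (\<sigma> (t + 1)) (\<lambda>x. \<sigma> t)) = 1"
      using kern by (intro prod.neutral) simp
    also have "p * 1 * (\<Prod>x\<in>{1..k}. psi k \<theta> T True (2 * J) \<sigma> \<sigma>) = p * psi k \<theta> T True (2 * J) \<sigma> \<sigma> ^ k"
      by simp
    finally have "c \<le> \<P>(f in ?L. ?E f)"
      using psi_c0[of "2 * J"] p c0 unfolding c_def
      by (simp only:) (intro mult_left_mono power_mono; simp)
    also have "\<dots> \<le> prob (B J)"
    proof (rule finite_measure_mono_AE[OF _ B])
      show "AE f in ?L. f \<in> {f \<in> space ?L. ?E f} \<longrightarrow> f \<in> B J"
        using AE_law_values[where \<theta> = \<theta> and V = ?V]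
      proof eventually_elim
        case (elim f)
        show ?case
        proof
          assume f: "f \<in> {f \<in> space ?L. ?E f}"
          have "?\<eta> f (T + 2 * j) [] = - 1" if "j \<le> J" for j
          proof (rule root_minus[OF k elim, where d = "2 * (J - j)"])
            show "?\<eta> f T [] = - 1" using f \<sigma>t[of T] by auto
            have "2 * (J - j) + 2 * j = 2 * J" using that by simp
            then show "\<forall>x\<in>{1..k}. alt_core k True (2 * (J - j) + 2 * j) (?\<eta> f T) [x]" using f by simp
          qed
          then show "f \<in> B J" using f by (simp add: B_def)
        qed
      qed
    qed
    finally show ?thesis .
  qed
  \<comment> \<open>The bound survives the limit in \<open>J\<close>, so with probability at least
    \<open>c\<close> the root is \<open>- 1\<close> at all times \<open>T + 2 * j\<close>, against
    consensus.\<close>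
  have "decseq B" unfolding decseq_def B_def by auto
  then have "(\<lambda>J. prob (B J)) \<longlonglongrightarrow> prob (\<Inter>J. B J)"
    using B by (intro finite_Lim_measure_decseq) auto
  then have "c \<le> prob (\<Inter>J. B J)"
    using pB by (intro LIMSEQ_le_const) auto
  moreover have "prob (\<Inter>J. B J) = prob {}"
  proof (rule finite_measure_eq_AE)
    show "AE f in ?L. f \<in> (\<Inter>J. B J) \<longleftrightarrow> f \<in> {}"
      using cons
    proof eventually_elim
      case (elim f)
      then obtain N where N: "\<And>n. n \<ge> N \<Longrightarrow> ?\<eta> f n [] = 1"
        using Vnil unfolding consensus_def int_tendsto_iff by blast
      have "?\<eta> f (T + 2 * N) [] = - 1" if "f \<in> B N" using that by (simp add: B_def)
      then show ?case using N[of "T + 2 * N"] by auto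
    qed
    show "(\<Inter>J. B J) \<in> events" using B by blast
  qed simp
  ultimately show False using c by simp
qed

text \<open>Makes the set in \<open>theta_star\<close> nonempty, without which its infimum would be
  unspecified.\<close>

lemma consensus_1:
  assumes k: "k \<ge> 2"
  shows "AE f in law 1 (regular_tree k). consensus (regular_tree k) f"
proof -
  let ?V = "regular_tree k"
  have "AE f in law 1 ?V. \<forall>v\<in>?V. f (v, 0) = 1"
  proof (rule AE_ball_countable[THEN iffD2, OF _ ballI])
    fix v assume v: "v \<in> ?V"
    have "AE x in site 1 (v, 0). x = 1"
      unfolding site_def by (auto simp: AE_measure_pmf_iff spin_pmf_def set_pmf_iff)
    then show "AE f in law 1 ?V. f (v, 0) = 1"
      unfolding law_def by (intro AE_PiM_component prob_space_site) (use v in auto)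
  qed simp
  then show ?thesis
  proof eventually_elim
    case (elim f)
    have "v \<in> ?V \<Longrightarrow> dyn ?V (\<lambda>_. 0) f t v = 1" for t v
    proof (induction t arbitrary: v)
      case 0
      then show ?case using elim by simp
    next
      case (Suc t)
      have "(\<Sum>j\<in>nbrs ?V v. dyn ?V (\<lambda>_. 0) f t j) = (\<Sum>j\<in>nbrs ?V v. 1)"
        using nbrs_subset by (intro sum.cong refl Suc.IH) blast
      also have "\<dots> = int k" using card_nbrs_regular_tree[OF k Suc.prems] by simp
      finally show ?case using k by simp
    qed
    then show ?case by (simp add: consensus_def)
  qed
qed

theorem theorem2p9:
  fixes k T :: nat
  assumes "k \<ge> 2"
  shows "(\<forall>\<theta>\<in>{- 1..1}. \<forall>\<sigma>\<in>trajs T. \<forall>u\<in>trajs T. convergent (\<lambda>d. psi_odd k \<theta> T d \<sigma> u))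
    \<and> theta_star k \<ge> theta_lb k T"
proof (intro conjI ballI)
  fix \<theta> :: real and \<sigma> u assume \<sigma>: "\<sigma> \<in> trajs T"
  show "convergent (\<lambda>d. psi_odd k \<theta> T d \<sigma> u)"
    using psi_convergent[of k \<theta> T True \<sigma> u] psi_odd_even_eq_psi(1)[OF _ \<sigma>, of k \<theta> _ u] assms by simp
next
  let ?V = "regular_tree k"
  define C where "C = {\<theta> \<in> {- 1..1 :: real}. AE f in law \<theta> ?V. consensus ?V f}"
  have star: "theta_star k = Inf C"
    unfolding theta_star_def C_def prob_majority_consensus ..
  define S where "S = {\<theta> \<in> {0..1 :: real}. \<forall>\<sigma>\<in>trajs T. \<forall>u\<in>trajs T. psi_odd_lim k \<theta> T \<sigma> u > 0}"
  have lb: "theta_lb k T = (if S = {} then 0 else Sup S)"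
    unfolding theta_lb_def S_def Let_def ..
  have "1 \<in> C" using consensus_1[OF assms] by (simp add: C_def)
  then have "C \<noteq> {}" by blast
  then show "theta_lb k T \<le> theta_star k"
    unfolding star
  proof (rule cInf_greatest)
    fix \<theta>' assume "\<theta>' \<in> C"
    then have \<theta>': "- 1 \<le> \<theta>'" "\<theta>' \<le> 1" and cons: "AE f in law \<theta>' ?V. consensus ?V f"
      by (auto simp: C_def)
    \<comment> \<open>Consensus at a negative parameter would propagate to 0. This bound settles the
      case where \<open>theta_lb\<close> is 0 by convention.\<close>
    have "0 \<le> \<theta>'"
    proof (rule ccontr)
      assume "\<not> 0 \<le> \<theta>'"
      then have "AE f in law 0 ?V. consensus ?V f"
        using consensus_mono[OF \<theta>'(1) _ _ cons, of 0] by simp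
      moreover have "?V \<noteq> {}" by (metis empty_iff regular_tree_eq tree_Nil)
      ultimately show False using no_consensus_0 by blast
    qed
    \<comment> \<open>Otherwise consensus would propagate upwards from \<open>\<theta>'\<close> to a
      parameter of \<open>S\<close>.\<close>
    moreover have "\<theta> \<le> \<theta>'" if "\<theta> \<in> S" for \<theta>
    proof (rule ccontr)
      assume "\<not> \<theta> \<le> \<theta>'"
      then have "AE f in law \<theta> ?V. consensus ?V f"
        using consensus_mono[OF \<theta>'(1) _ _ cons, of \<theta>] that by (simp add: S_def)
      then show False using no_consensus[OF assms, of \<theta> T] that by (simp add: S_def)
    qed
    ultimately show "theta_lb k T \<le> \<theta>'"
      unfolding lb by (simp add: cSup_least)
  qed
qed

end
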